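(* Assume (A1)–(A4). For $\alpha\in(0,1)$ let $u_\alpha\in C(\overline{Q_T})$ be the viscosity solution of the initial value problem $\partial_t^\alpha u+H(t,x,u,Du)=0$ in $Q_T$, $u(0,\cdot)=u_0$. Let $\beta\in(0,1]$ and let $u_\beta$ be the viscosity solution of the same initial value problem with time-derivative order $\beta$ (for $\beta=1$: $\partial_tu+H(t,x,u,Du)=0$, $u(0,\cdot)=u_0$). Then $u_\alpha\to u_\beta$ locally uniformly in $Q_T$ as $\alpha\to\beta$.
   Context: Fix $d\ge1$, $T>0$. $\mathbb{T}^d=\mathbb{R}^d/\mathbb{Z}^d$; functions on $[0,T]\times\mathbb{T}^d$ are identified with functions on $[0,T]\times\mathbb{R}^d$ $\mathbb{Z}^d$-periodic in $x$. $Q_T=(0,T]\times\mathbb{T}^d$, $\overline{Q_T}=[0,T]\times\mathbb{T}^d$; $D$ spatial gradient. For $\alpha\in(0,1)$, $\partial_t^\alpha$ is Caputo's derivative $(\partial_t^\alpha f)(t)=\frac{1}{\Gamma(1-\alpha)}\int_0^t f'(s)(t-s)^{-\alpha}ds$, and $\partial_t^1=\partial_t$. $H:\overline{Q_T}\times\mathbb{R}\times\mathbb{R}^d\to\mathbb{R}$, $u_0:\mathbb{T}^d\to\mathbb{R}$. Assumptions: (A1) $H$ continuous. (A2) there is a modulus $\omega$ with $|H(t,x,r,p)-H(t,y,r,p)|\le\omega(|x-y|(1+|p|))$ for all $t\in[0,T]$, $x,y\in\mathbb{R}^d$, $r\in\mathbb{R}$, $p\in\mathbb{R}^d$. (A3)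 $r\mapsto H(t,x,r,p)$ nondecreasing. (A4) $u_0$ continuous. $\mathcal{C}^1([a,b]\times O)=\{\phi\in C^1((a,b]\times O)\cap C([a,b]\times O):\partial_t\phi(\cdot,x)\in L^1(a,b)\ \forall x\in O\}$. For $\alpha\in(0,1)$, measurable $f(t,x)$, $t\in(0,T]$, $r\in[0,t]$: $J_r[f](t,x)=\frac{\alpha}{\Gamma(1-\alpha)}\int_0^r (f(t,x)-f(t-\tau,x))\tau^{-\alpha-1}d\tau$, $K_r[f](t,x)=\frac{f(t,x)-f(0,x)}{t^\alpha\Gamma(1-\alpha)}+\frac{\alpha}{\Gamma(1-\alpha)}\int_r^t (f(t,x)-f(t-\tau,x))\tau^{-\alpha-1}d\tau$ (improper at lower limit $0$). For $\alpha\in(0,1)$, viscosity sub/supersolution: $u\in USC(\overline{Q_T})$ (resp. $LSC$) such that for all $a<b$ in $[0,T]$, every open ball $B\subset\mathbb{R}^d$, every $\phi\in\mathcal{C}^1([0,T]\times\mathbb{R}^d)$ and every $(\hat t,\hat x)\in(a,b]\times B$ where $u-\phi$ attains its maximum (resp. minimum) over $[a,b]\times\overline B$: $J_{\hat t-a}[\phi](\hat t,\hat x)+K_{\hat t-a}[u](\hat t,\hat x)+H(\hat t,\hat x,u(\hat t,\hat x),D\phi(\hat t,\hat x))\le0$ (resp. $\ge0$). For order $1$, the standard notion: whenever $\phi\in C^1$ and $u-\phi$ has a local maximum (resp. minimum) at $(\hat t,\hat x)\in Q_T$, $\partial_t\phi(\hat t,\hat x)+H(\hat t,\hat x,u(\hat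 t,\hat x),D\phi(\hat t,\hat x))\le0$ (resp. $\ge0$). In both cases a viscosity solution of the initial value problem is $u\in C(\overline{Q_T})$ that is both, with $u(0,\cdot)=u_0$. *)

theory Defs
  imports "HOL-Analysis.Analysis"
begin

text \<open>Functions on [0,T] x T^d are represented as functions real => real^'d => real,
  Z^d-periodic in the space variable.\<close>

definition int_vec :: "real^'d \<Rightarrow> bool" where
  "int_vec z \<longleftrightarrow> (\<forall>i. z $ i \<in> \<int>)"

definition periodic_x :: "(real \<Rightarrow> real^'d \<Rightarrow> real) \<Rightarrow> bool" where
  "periodic_x u \<longleftrightarrow> (\<forall>t x z. int_vec z \<longrightarrow> u t (x + z) = u t x)"

definition periodic_fn :: "(real^'d \<Rightarrow> real) \<Rightarrow> bool" where
  "periodic_fn f \<longleftrightarrow> (\<forall>x z. int_vec z \<longrightarrow> f (x + z) = f x)"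

definition modulus :: "(real \<Rightarrow> real) \<Rightarrow> bool" where
  "modulus \<omega> \<longleftrightarrow> \<omega> 0 = 0 \<and> (\<forall>r\<ge>0. \<omega> r \<ge> 0) \<and> mono_on {0..} \<omega> \<and> (\<omega> \<longlongrightarrow> 0) (at_right 0)"

definition usc_on :: "('a::metric_space) set \<Rightarrow> ('a \<Rightarrow> real) \<Rightarrow> bool" where
  "usc_on S f \<longleftrightarrow> (\<forall>p\<in>S. \<forall>e>0. \<exists>d>0. \<forall>q\<in>S. dist q p < d \<longrightarrow> f q < f p + e)"

definition lsc_on :: "('a::metric_space) set \<Rightarrow> ('a \<Rightarrow> real) \<Rightarrow> bool" where
  "lsc_on S f \<longleftrightarrow> (\<forall>p\<in>S. \<forall>e>0. \<exists>d>0. \<forall>q\<in>S. dist q p < d \<longrightarrow> f q > f p - e)"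

definition improper0 :: "(real \<Rightarrow> real) \<Rightarrow> real \<Rightarrow> real" where
  "improper0 g r = Lim (at_right 0) (\<lambda>\<epsilon>. integral {\<epsilon>..r} g)"

definition Jop :: "real \<Rightarrow> real \<Rightarrow> (real \<Rightarrow> real^'d \<Rightarrow> real) \<Rightarrow> real \<Rightarrow> real^'d \<Rightarrow> real" where
  "Jop \<alpha> r f t x = \<alpha> / Gamma (1 - \<alpha>) *
     improper0 (\<lambda>\<tau>. (f t x - f (t - \<tau>) x) * \<tau> powr (- \<alpha> - 1)) r"

text \<open>K_r: the integral over [r,t], improper at the lower limit 0 (relevant only if r = 0).\<close>
definition Kop :: "real \<Rightarrow> real \<Rightarrow> (real \<Rightarrow> real^'d \<Rightarrow> real) \<Rightarrow> real \<Rightarrow> real^'d \<Rightarrow> real" where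
  "Kop \<alpha> r f t x = (f t x - f 0 x) / (t powr \<alpha> * Gamma (1 - \<alpha>)) + \<alpha> / Gamma (1 - \<alpha>) *
     Lim (at_right 0) (\<lambda>\<epsilon>. integral {max r \<epsilon>..t} (\<lambda>\<tau>. (f t x - f (t - \<tau>) x) * \<tau> powr (- \<alpha> - 1)))"

definition C1_on :: "real \<Rightarrow> (real \<Rightarrow> real^'d \<Rightarrow> real) \<Rightarrow> (real \<Rightarrow> real^'d \<Rightarrow> real)
     \<Rightarrow> (real \<Rightarrow> real^'d \<Rightarrow> real^'d) \<Rightarrow> bool" where
  "C1_on T \<phi> \<phi>t D\<phi> \<longleftrightarrow>
     (\<forall>t x. t \<in> {0<..T} \<longrightarrow>
        ((\<lambda>p. \<phi> (fst p) (snd p)) has_derivative (\<lambda>h. fst h * \<phi>t t x + D\<phi> t x \<bullet> snd h))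
          (at (t, x) within {0<..T} \<times> UNIV)) \<and>
     continuous_on ({0<..T} \<times> UNIV) (\<lambda>p. \<phi>t (fst p) (snd p)) \<and>
     continuous_on ({0<..T} \<times> UNIV) (\<lambda>p. D\<phi> (fst p) (snd p))"

definition C1frac :: "real \<Rightarrow> (real \<Rightarrow> real^'d \<Rightarrow> real) \<Rightarrow> (real \<Rightarrow> real^'d \<Rightarrow> real)
     \<Rightarrow> (real \<Rightarrow> real^'d \<Rightarrow> real^'d) \<Rightarrow> bool" where
  "C1frac T \<phi> \<phi>t D\<phi> \<longleftrightarrow> C1_on T \<phi> \<phi>t D\<phi> \<and>
     continuous_on ({0..T} \<times> UNIV) (\<lambda>p. \<phi> (fst p) (snd p)) \<and>
     (\<forall>x. (\<lambda>t. \<phi>t t x) absolutely_integrable_on {0..T})"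

definition loc_max_QT :: "real \<Rightarrow> (real \<Rightarrow> real^'d \<Rightarrow> real) \<Rightarrow> real \<Rightarrow> real^'d \<Rightarrow> bool" where
  "loc_max_QT T w t x \<longleftrightarrow> (\<exists>d>0. \<forall>s y. s \<in> {0<..T} \<and> dist (s, y) (t, x) < d \<longrightarrow> w s y \<le> w t x)"

definition loc_min_QT :: "real \<Rightarrow> (real \<Rightarrow> real^'d \<Rightarrow> real) \<Rightarrow> real \<Rightarrow> real^'d \<Rightarrow> bool" where
  "loc_min_QT T w t x \<longleftrightarrow> (\<exists>d>0. \<forall>s y. s \<in> {0<..T} \<and> dist (s, y) (t, x) < d \<longrightarrow> w s y \<ge> w t x)"

definition visc_sub :: "real \<Rightarrow> real \<Rightarrow> (real \<Rightarrow> real^'d \<Rightarrow> real \<Rightarrow> real^'d \<Rightarrow> real)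
     \<Rightarrow> (real \<Rightarrow> real^'d \<Rightarrow> real) \<Rightarrow> bool" where
  "visc_sub \<alpha> T H u \<longleftrightarrow> periodic_x u \<and> usc_on ({0..T} \<times> UNIV) (\<lambda>p. u (fst p) (snd p)) \<and>
    (if \<alpha> < 1 then
      (\<forall>a b c \<rho> \<phi> \<phi>t D\<phi> t x. 0 \<le> a \<and> a < b \<and> b \<le> T \<and> \<rho> > 0 \<and> C1frac T \<phi> \<phi>t D\<phi> \<and>
         t \<in> {a<..b} \<and> x \<in> ball c \<rho> \<and>
         (\<forall>s\<in>{a..b}. \<forall>y\<in>cball c \<rho>. u s y - \<phi> s y \<le> u t x - \<phi> t x) \<longrightarrow>
         Jop \<alpha> (t - a) \<phi> t x + Kop \<alpha> (t - a) u t x + H t x (u t x) (D\<phi> t x) \<le> 0)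
    else
      (\<forall>\<phi> \<phi>t D\<phi> t x. C1_on T \<phi> \<phi>t D\<phi> \<and> t \<in> {0<..T} \<and>
         loc_max_QT T (\<lambda>s y. u s y - \<phi> s y) t x \<longrightarrow>
         \<phi>t t x + H t x (u t x) (D\<phi> t x) \<le> 0))"

definition visc_super :: "real \<Rightarrow> real \<Rightarrow> (real \<Rightarrow> real^'d \<Rightarrow> real \<Rightarrow> real^'d \<Rightarrow> real)
     \<Rightarrow> (real \<Rightarrow> real^'d \<Rightarrow> real) \<Rightarrow> bool" where
  "visc_super \<alpha> T H u \<longleftrightarrow> periodic_x u \<and> lsc_on ({0..T} \<times> UNIV) (\<lambda>p. u (fst p) (snd p)) \<and>
    (if \<alpha> < 1 then
      (\<forall>a b c \<rho> \<phi> \<phi>t D\<phi> t x. 0 \<le> a \<and> a < b \<and> b \<le> T \<and> \<rho> > 0 \<and> C1frac T \<phi> \<phi>t D\<phi> \<and>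
         t \<in> {a<..b} \<and> x \<in> ball c \<rho> \<and>
         (\<forall>s\<in>{a..b}. \<forall>y\<in>cball c \<rho>. u s y - \<phi> s y \<ge> u t x - \<phi> t x) \<longrightarrow>
         Jop \<alpha> (t - a) \<phi> t x + Kop \<alpha> (t - a) u t x + H t x (u t x) (D\<phi> t x) \<ge> 0)
    else
      (\<forall>\<phi> \<phi>t D\<phi> t x. C1_on T \<phi> \<phi>t D\<phi> \<and> t \<in> {0<..T} \<and>
         loc_min_QT T (\<lambda>s y. u s y - \<phi> s y) t x \<longrightarrow>
         \<phi>t t x + H t x (u t x) (D\<phi> t x) \<ge> 0))"

definition visc_solution :: "real \<Rightarrow> real \<Rightarrow> (real \<Rightarrow> real^'d \<Rightarrow> real \<Rightarrow> real^'d \<Rightarrow> real)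
     \<Rightarrow> (real^'d \<Rightarrow> real) \<Rightarrow> (real \<Rightarrow> real^'d \<Rightarrow> real) \<Rightarrow> bool" where
  "visc_solution \<alpha> T H u0 u \<longleftrightarrow>
     continuous_on ({0..T} \<times> UNIV) (\<lambda>p. u (fst p) (snd p)) \<and>
     visc_sub \<alpha> T H u \<and> visc_super \<alpha> T H u \<and> (\<forall>x. u 0 x = u0 x)"

end

(* Doubling variables directly between the solutions of order alpha and beta.  At a maximum of
   U alpha t x - U beta s y - k (t - s)^2 - l |x - y|^2 - m t the nonlocal parts of the two operators are
   compared increment by increment; the term m t leaves a strictly positive gap.  For fixed k and r the
   explicit J-part of the quadratic test function and the K-part of the fixed function U beta (whose kernel
   is cut off at r) depend continuously on the order, uniformly in the maximum point, so that one may let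
   alpha tend to beta.  Only U beta needs to be uniformly continuous; for U alpha one needs the uniform
   bound U alpha t x <= u0 x + eta + C t, which comes from the same doubling with u0 in place of U beta.
   With 1 / Gamma (1 - alpha) written as the entire function rGamma, order 1 is not a special case: the
   kernel vanishes there and the J-part becomes the time derivative. *)

theory Submission
  imports Defs
begin

text \<open>No modulus of continuity uniform in the order is available for
  \<open>U \<alpha>\<close>. Penalties are therefore controlled by varying only the point of
  \<open>U \<beta>\<close>: replacing \<open>y\<close> by \<open>x\<close>, or \<open>s\<close> by
  \<open>t\<close>, at a maximum bounds each penalty by an oscillation of \<open>U \<beta>\<close>.
  This is why \<open>k\<close> and \<open>l\<close> can be numbers fixed in advance instead of
  parameters sent to infinity. For the same reason the increments of \<open>U \<alpha>\<close> are
  eliminated before the order is changed: the operator of order alpha then acts on a function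
  bounded independently of alpha.

  The two equations see the time penalty with opposite curvature, \<open>- k\<close> for the
  subsolution and \<open>+ k\<close> for the supersolution. On \<open>[0, r]\<close> this mismatch
  costs a multiple of k r^(2 - beta), so r is chosen small after k, but positive, since the kernel
  is continuous in the order only away from its singularity. A fixed positive r needs maximum points
  away from the initial time; the bound on \<open>U \<alpha>\<close> near time 0 serves to guarantee
  this.

  The estimate from below is the estimate from above for \<open>- u\<close> and a reflected
  Hamiltonian.\<close>

section \<open>The operators J and K on quadratic test functions\<close>

text \<open>J over [0,r] of a function with backward increment \<open>A \<tau> + B \<tau>\<^sup>2\<close>, plus K of a function with
  backward increment \<open>g \<tau>\<close>, where g is constant from the current time to R.\<close>
definition frac_op :: "real \<Rightarrow> real \<Rightarrow> real \<Rightarrow> real \<Rightarrow> real \<Rightarrow> (real \<Rightarrow> real) \<Rightarrow> real" where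
  "frac_op \<alpha> r R A B g =
     \<alpha> * rGamma (2 - \<alpha>) * A * r powr (1 - \<alpha>) + \<alpha> * rGamma (1 - \<alpha>) * B * r powr (2 - \<alpha>) / (2 - \<alpha>)
     + \<alpha> * rGamma (1 - \<alpha>) * integral {r..R} (\<lambda>\<tau>. g \<tau> * \<tau> powr (- \<alpha> - 1))
     + rGamma (1 - \<alpha>) * g R * R powr (- \<alpha>)"

text \<open>The factor \<open>1 - \<alpha>\<close> cancels the denominator that arises from
  integrating \<open>\<tau> powr (- \<alpha>)\<close>, so the linear coefficient of
  \<open>frac_op\<close> stays regular at order 1.\<close>

lemma rGamma_one_minus: "rGamma (1 - \<alpha>) = (1 - \<alpha>) * rGamma (2 - \<alpha> :: real)"
  using rGamma_plus1[of "1 - \<alpha>"] by (simp add: algebra_simps)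

text \<open>The increment vanishes to first order at 0, so for \<open>\<alpha> < 1\<close> the
  integrand is integrable up to 0, and the improper integral is an ordinary one by continuity in the
  lower limit.\<close>

lemma Jop_quadratic:
  assumes \<alpha>: "0 < \<alpha>" "\<alpha> < 1" and r: "0 < r"
    and incr: "\<And>\<tau>. \<tau> \<in> {0..r} \<Longrightarrow> f t x - f (t - \<tau>) x = A * \<tau> + B * \<tau>\<^sup>2"
  shows "Jop \<alpha> r f t x =
    \<alpha> * rGamma (2 - \<alpha>) * A * r powr (1 - \<alpha>) + \<alpha> * rGamma (1 - \<alpha>) * B * r powr (2 - \<alpha>) / (2 - \<alpha>)"
proof -
  define g where "g = (\<lambda>\<tau>. (f t x - f (t - \<tau>) x) * \<tau> powr (- \<alpha> - 1))"
  let ?I = "A * (r powr (1 - \<alpha>) / (1 - \<alpha>)) + B * (r powr (2 - \<alpha>) / (2 - \<alpha>))"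
  have "((\<lambda>\<tau>. A * \<tau> powr (-\<alpha>) + B * \<tau> powr (1 - \<alpha>)) has_integral ?I) {0..r}"
    using has_integral_powr_from_0[of "-\<alpha>" r] has_integral_powr_from_0[of "1-\<alpha>" r] \<alpha> r
    by (intro has_integral_add has_integral_mult_right) (auto simp: algebra_simps)
  moreover have "A * \<tau> powr (-\<alpha>) + B * \<tau> powr (1 - \<alpha>) = g \<tau>" if "\<tau> \<in> {0..r}" for \<tau>
  \<comment> \<open>By the convention \<open>0 powr a = 0\<close>, both sides vanish at the
    endpoint.\<close>
  proof (cases "\<tau> = 0")
    case False
    with that have p: "\<tau> > 0" by auto
    have "\<tau> powr (-\<alpha>) = \<tau> * \<tau> powr (-\<alpha>-1)" "\<tau> powr (1-\<alpha>) = \<tau>\<^sup>2 * \<tau> powr (-\<alpha>-1)"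
      using powr_add[of \<tau> 1 "-\<alpha>-1"] powr_add[of \<tau> 2 "-\<alpha>-1"] p by simp_all
    then show ?thesis using incr[OF that] by (simp add: g_def algebra_simps)
  qed (simp add: g_def)
  ultimately have I: "(g has_integral ?I) {0..r}"
    by (rule has_integral_eq[rotated])
  then have "continuous_on {0..r} (\<lambda>\<epsilon>. integral {\<epsilon>..r} g)"
    by (intro indefinite_integral_continuous_1') (auto simp: integrable_on_def)
  then have "((\<lambda>\<epsilon>. integral {\<epsilon>..r} g) \<longlongrightarrow> integral {0..r} g) (at 0 within {0..r})"
    using r by (auto simp: continuous_on_def)
  then have "((\<lambda>\<epsilon>. integral {\<epsilon>..r} g) \<longlongrightarrow> ?I) (at_right 0)"
    using r I by (simp add: at_within_Icc_at_right integral_unique)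
  then have "improper0 g r = ?I"
    unfolding improper0_def by (intro tendsto_Lim) auto
  then have "Jop \<alpha> r f t x = \<alpha> * rGamma (1 - \<alpha>) * ?I"
    by (simp add: Jop_def g_def rGamma_inverse_Gamma field_simps)
  moreover have "rGamma (1 - \<alpha>) * (A * (r powr (1 - \<alpha>) / (1 - \<alpha>))) = rGamma (2 - \<alpha>) * A * r powr (1 - \<alpha>)"
    using \<alpha> by (simp add: rGamma_one_minus[of \<alpha>])
  ultimately show ?thesis
    by (simp add: distrib_left mult.assoc flip: times_divide_eq_right)
qed

text \<open>Freezing the function before time 0 turns the boundary term of K into a tail of the integral,
  so that the upper limit of integration no longer depends on the time.\<close>
lemma Kop_eq_frac_op:
  assumes \<alpha>: "0 < \<alpha>" "\<alpha> < 1" and r: "0 < r" "r \<le> t" "t \<le> R"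
    and cont: "continuous_on {0..t} (\<lambda>s. f s x)"
  shows "Kop \<alpha> r f t x = frac_op \<alpha> r R 0 0 (\<lambda>\<tau>. f t x - f (max (t - \<tau>) 0) x)"
proof -
  define g where "g = (\<lambda>\<tau>. f t x - f (max (t - \<tau>) 0) x)"
  define h where "h = (\<lambda>\<tau>. g \<tau> * \<tau> powr (- \<alpha> - 1))"
  have "continuous_on {r..t} (\<lambda>\<tau>. f (max (t - \<tau>) 0) x)"
    by (rule continuous_on_compose2[OF cont]) (use r in \<open>auto intro!: continuous_intros\<close>)
  then have "continuous_on {r..t} h"
    unfolding h_def g_def using r by (auto intro!: continuous_intros)
  then have h1: "h integrable_on {r..t}" by (rule integrable_continuous_real)
  have tail: "((\<lambda>\<tau>. \<tau> powr (-\<alpha>-1)) has_integral ((- (R powr (-\<alpha>) / \<alpha>)) - (- (t powr (-\<alpha>) / \<alpha>)))) {t..R}"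
    using r \<alpha> by (intro fundamental_theorem_of_calculus)
      (auto intro!: derivative_eq_intros simp: has_real_derivative_iff_has_vector_derivative[symmetric])
  have "(h has_integral g R * ((- (R powr (-\<alpha>) / \<alpha>)) - (- (t powr (-\<alpha>) / \<alpha>)))) {t..R}"
    by (rule has_integral_eq[OF _ has_integral_mult_right[OF tail]]) (use r in \<open>auto simp: h_def g_def max_def\<close>)
  with h1 have "(h has_integral (integral {r..t} h + g R * ((- (R powr (-\<alpha>) / \<alpha>)) - (- (t powr (-\<alpha>) / \<alpha>))))) {r..R}"
    using r by (intro has_integral_combine[of r t R]) auto
  then have I: "integral {r..R} h = integral {r..t} h + g R * (t powr (-\<alpha>) - R powr (-\<alpha>)) / \<alpha>"
    using \<alpha> by (auto dest!: integral_unique simp: field_simps)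
  let ?h = "\<lambda>\<tau>. (f t x - f (t - \<tau>) x) * \<tau> powr (- \<alpha> - 1)"
  have "eventually (\<lambda>\<epsilon>. integral {max r \<epsilon>..t} ?h = integral {r..t} ?h) (at_right 0)"
    using eventually_at_right_real[OF \<open>0 < r\<close>] by eventually_elim (auto simp: max_def)
  then have "Lim (at_right 0) (\<lambda>\<epsilon>. integral {max r \<epsilon>..t} ?h) = integral {r..t} ?h"
    by (intro tendsto_Lim tendsto_eventually) auto
  also have "\<dots> = integral {r..t} h"
    by (intro integral_cong) (auto simp: h_def g_def max_def)
  finally have "Kop \<alpha> r f t x = rGamma (1-\<alpha>) * g R * t powr (-\<alpha>) + \<alpha> * rGamma (1 - \<alpha>) * integral {r..t} h"
    using r by (simp add: Kop_def g_def max_def rGamma_inverse_Gamma powr_minus field_simps)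
  also have "\<dots> = frac_op \<alpha> r R 0 0 g"
    using \<alpha> unfolding frac_op_def h_def[symmetric] I by (simp add: right_diff_distrib distrib_left diff_divide_distrib mult_ac)
  finally show ?thesis by (simp add: g_def)
qed

section \<open>From the viscosity inequalities of every order to quadratic test functions\<close>

lemma C1frac_quadratic:
  fixes y0 :: "real^'d"
  shows "C1frac T (\<lambda>s y. k * (s - s0)\<^sup>2 + m * s + l * (norm (y - y0))\<^sup>2)
     (\<lambda>s y. 2 * k * (s - s0) + m) (\<lambda>s y. (2 * l) *\<^sub>R (y - y0))"
proof -
  have "((\<lambda>p. k * (fst p - s0)\<^sup>2 + m * fst p + l * (norm (snd p - y0))\<^sup>2) has_derivative
      (\<lambda>h. fst h * (2 * k * (s - s0) + m) + ((2 * l) *\<^sub>R (y - y0)) \<bullet> snd h)) (at (s, y) within S)"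
    for s and y :: "real^'d" and S
    unfolding power2_norm_eq_inner
    by (rule derivative_eq_intros refl | simp add: algebra_simps inner_commute)+
  moreover have "(\<lambda>s. 2 * k * (s - s0) + m) absolutely_integrable_on {0..T}"
    by (intro absolutely_integrable_continuous_real continuous_intros)
  ultimately show ?thesis
    unfolding C1frac_def C1_on_def by (auto intro!: continuous_intros)
qed

text \<open>The one consequence of the subsolution property that the proof uses, in a form common to
  all orders in (0,1]. The maximum is global in time, as doubling provides it, but local in space:
  the radius 1/2 keeps the ball inside the constraint |x - y| \<le> 1 of the doubling problem when
  the two points are at distance at most 1/2.\<close>

definition quad_subsol :: "real \<Rightarrow> real \<Rightarrow> (real \<Rightarrow> real^'d \<Rightarrow> real \<Rightarrow> real^'d \<Rightarrow> real)
     \<Rightarrow> (real \<Rightarrow> real^'d \<Rightarrow> real) \<Rightarrow> bool" where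
  "quad_subsol \<alpha> T H u \<longleftrightarrow> (\<forall>k s0 m l y0 t x r R.
     0 < r \<and> r \<le> t \<and> t \<le> T \<and> t \<le> R \<and>
     (\<forall>s\<in>{0..T}. \<forall>y\<in>cball x (1/2).
        u s y - (k * (s - s0)\<^sup>2 + m * s + l * (norm (y - y0))\<^sup>2)
        \<le> u t x - (k * (t - s0)\<^sup>2 + m * t + l * (norm (x - y0))\<^sup>2)) \<longrightarrow>
     frac_op \<alpha> r R (2 * k * (t - s0) + m) (- k) (\<lambda>\<tau>. u t x - u (max (t - \<tau>) 0) x)
       + H t x (u t x) ((2 * l) *\<^sub>R (x - y0)) \<le> 0)"

lemma quad_subsolD:
  assumes "quad_subsol \<alpha> T H u" "0 < r" "r \<le> t" "t \<le> T" "t \<le> R"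
    and "\<And>s y. s \<in> {0..T} \<Longrightarrow> y \<in> cball x (1/2) \<Longrightarrow>
        u s y - (k * (s - s0)\<^sup>2 + m * s + l * (norm (y - y0))\<^sup>2)
        \<le> u t x - (k * (t - s0)\<^sup>2 + m * t + l * (norm (x - y0))\<^sup>2)"
  shows "frac_op \<alpha> r R (2 * k * (t - s0) + m) (- k) (\<lambda>\<tau>. u t x - u (max (t - \<tau>) 0) x)
       + H t x (u t x) ((2 * l) *\<^sub>R (x - y0)) \<le> 0"
  using assms unfolding quad_subsol_def by blast

lemma rGamma_pos: "0 < x \<Longrightarrow> 0 < rGamma (x :: real)"
  by (simp add: rGamma_inverse_Gamma Gamma_real_pos)

lemma rGamma_nonneg: "0 \<le> x \<Longrightarrow> 0 \<le> rGamma (x :: real)"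
  using rGamma_pos[of x] by (cases "x = 0") auto

text \<open>The Hamiltonian for which \<open>- u\<close> is a subsolution when \<open>u\<close> is a
  supersolution for \<open>H\<close>; monotonicity in r and the modulus in x carry over.\<close>

definition dual_ham :: "(real \<Rightarrow> real^'d \<Rightarrow> real \<Rightarrow> real^'d \<Rightarrow> real) \<Rightarrow> real \<Rightarrow> real^'d \<Rightarrow> real \<Rightarrow> real^'d \<Rightarrow> real" where
  "dual_ham H t x r p = - H t x (- r) (- p)"

lemma dual_ham_dual_ham [simp]: "dual_ham (dual_ham H) = H"
  by (simp add: dual_ham_def fun_eq_iff)

lemma frac_op_one [simp]: "0 < r \<Longrightarrow> frac_op 1 r R A B g = A"
  by (simp add: frac_op_def)

lemma frac_op_uminus: "frac_op \<alpha> r R (- A) (- B) (\<lambda>\<tau>. - g \<tau>) = - frac_op \<alpha> r R A B g"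
  by (simp add: frac_op_def)

lemma Jop_plus_Kop_quadratic:
  assumes "0 < \<alpha>" "\<alpha> < 1" "0 < r" "r \<le> t" "t \<le> T" "t \<le> R"
    and cont: "continuous_on ({0..T} \<times> UNIV) (\<lambda>p. u (fst p) (snd p))"
  shows "Jop \<alpha> r (\<lambda>s y. k * (s - s0)\<^sup>2 + m * s + l * (norm (y - y0))\<^sup>2) t x + Kop \<alpha> r u t x
     = frac_op \<alpha> r R (2 * k * (t - s0) + m) (- k) (\<lambda>\<tau>. u t x - u (max (t - \<tau>) 0) x)"
proof -
  have "continuous_on {0..t} (\<lambda>s. u (fst (s, x)) (snd (s, x)))"
    by (rule continuous_on_compose2[OF cont]) (use assms in \<open>auto intro!: continuous_intros\<close>)
  then have K: "Kop \<alpha> r u t x = frac_op \<alpha> r R 0 0 (\<lambda>\<tau>. u t x - u (max (t - \<tau>) 0) x)"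
    using assms by (intro Kop_eq_frac_op) auto
  \<comment> \<open>The coefficients come from k (t - s0)^2 - k (t - tau - s0)^2 = 2 k (t - s0) tau
    - k tau^2; hence the sign in \<open>B = - k\<close>.\<close>
  show ?thesis unfolding K
    by (subst Jop_quadratic[where A = "2 * k * (t - s0) + m" and B = "- k"])
      (use assms in \<open>auto simp: frac_op_def power2_eq_square algebra_simps\<close>)
qed

lemma visc_sub_imp_quad_subsol:
  fixes u :: "real \<Rightarrow> real^'d \<Rightarrow> real"
  assumes \<alpha>: "\<alpha> \<in> {0<..1}"
    and cont: "continuous_on ({0..T} \<times> UNIV) (\<lambda>p. u (fst p) (snd p))"
    and sub: "visc_sub \<alpha> T H u"
  shows "quad_subsol \<alpha> T H u"
  unfolding quad_subsol_def
proof (intro allI impI, elim conjE)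
  fix k s0 m l t r R and x y0 :: "real^'d"
  assume r: "0 < r" "r \<le> t" "t \<le> T" "t \<le> R"
  let ?\<phi> = "\<lambda>s y. k * (s - s0)\<^sup>2 + m * s + l * (norm (y - y0))\<^sup>2"
  assume max: "\<forall>s\<in>{0..T}. \<forall>y\<in>cball x (1/2). u s y - ?\<phi> s y \<le> u t x - ?\<phi> t x"
  note C1 = C1frac_quadratic[of T k s0 m l y0]
  show "frac_op \<alpha> r R (2 * k * (t - s0) + m) (- k) (\<lambda>\<tau>. u t x - u (max (t - \<tau>) 0) x)
       + H t x (u t x) ((2 * l) *\<^sub>R (x - y0)) \<le> 0"
  proof (cases "\<alpha> < 1")
    case True
    \<comment> \<open>The interval [a,b] is [t - r, T], which makes the splitting radius t - a equal
      to r.\<close>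
    have "Jop \<alpha> (t - (t - r)) ?\<phi> t x + Kop \<alpha> (t - (t - r)) u t x
        + H t x (u t x) ((2 * l) *\<^sub>R (x - y0)) \<le> 0"
      by (rule sub[unfolded visc_sub_def if_P[OF True], THEN conjunct2, THEN conjunct2, rule_format,
            of "t - r" T "1/2" ?\<phi> "\<lambda>s y. 2 * k * (s - s0) + m" "\<lambda>s y. (2 * l) *\<^sub>R (y - y0)" t x x])
        (use C1 r max in auto)
    then show ?thesis
      using Jop_plus_Kop_quadratic[of \<alpha> r t T R u k s0 m l y0 x] True \<alpha> r cont by simp
  next
    case False
    have "loc_max_QT T (\<lambda>s y. u s y - ?\<phi> s y) t x"
      unfolding loc_max_QT_def
    proof (intro exI[of _ "1/2"] conjI allI impI; (elim conjE)?)
      fix s y assume "s \<in> {0<..T}" "dist (s, y) (t, x) < 1/2"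
      then show "u s y - ?\<phi> s y \<le> u t x - ?\<phi> t x"
        using max dist_snd_le[of "(s, y)" "(t, x)"] by (force simp: dist_commute)
    qed simp
    moreover have "C1_on T ?\<phi> (\<lambda>s y. 2 * k * (s - s0) + m) (\<lambda>s y. (2 * l) *\<^sub>R (y - y0))"
      using C1 by (simp add: C1frac_def)
    ultimately have "2 * k * (t - s0) + m + H t x (u t x) ((2 * l) *\<^sub>R (x - y0)) \<le> 0"
      by (intro sub[unfolded visc_sub_def if_not_P[OF False], THEN conjunct2, THEN conjunct2, rule_format,
            of ?\<phi> "\<lambda>s y. 2 * k * (s - s0) + m" "\<lambda>s y. (2 * l) *\<^sub>R (y - y0)" t x])
        (use r in auto)
    then show ?thesis using False \<alpha> r by (simp add: not_less)
  qed
qed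

lemma visc_super_imp_quad_subsol:
  fixes u :: "real \<Rightarrow> real^'d \<Rightarrow> real"
  assumes \<alpha>: "\<alpha> \<in> {0<..1}"
    and cont: "continuous_on ({0..T} \<times> UNIV) (\<lambda>p. u (fst p) (snd p))"
    and super: "visc_super \<alpha> T H u"
  shows "quad_subsol \<alpha> T (dual_ham H) (\<lambda>s y. - u s y)"
  unfolding quad_subsol_def
proof (intro allI impI, elim conjE)
  fix k s0 m l t r R and x y0 :: "real^'d"
  assume r: "0 < r" "r \<le> t" "t \<le> T" "t \<le> R"
  let ?\<phi> = "\<lambda>s y. (- k) * (s - s0)\<^sup>2 + (- m) * s + (- l) * (norm (y - y0))\<^sup>2"
  let ?\<psi> = "\<lambda>s y. k * (s - s0)\<^sup>2 + m * s + l * (norm (y - y0))\<^sup>2"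
  let ?p = "(2 * l) *\<^sub>R (x - y0)"
  assume "\<forall>s\<in>{0..T}. \<forall>y\<in>cball x (1/2). - u s y - ?\<psi> s y \<le> - u t x - ?\<psi> t x"
  then have min: "\<forall>s\<in>{0..T}. \<forall>y\<in>cball x (1/2). u s y - ?\<phi> s y \<ge> u t x - ?\<phi> t x"
    by (simp add: algebra_simps)
  note C1 = C1frac_quadratic[of T "-k" s0 "-m" "-l" y0]
  have "frac_op \<alpha> r R (2 * (-k) * (t - s0) + (-m)) (- (-k)) (\<lambda>\<tau>. u t x - u (max (t - \<tau>) 0) x)
       + H t x (u t x) ((2 * (-l)) *\<^sub>R (x - y0)) \<ge> 0"
  proof (cases "\<alpha> < 1")
    case True
    have "Jop \<alpha> (t - (t - r)) ?\<phi> t x + Kop \<alpha> (t - (t - r)) u t x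
        + H t x (u t x) ((2 * (-l)) *\<^sub>R (x - y0)) \<ge> 0"
      by (rule super[unfolded visc_super_def if_P[OF True], THEN conjunct2, THEN conjunct2, rule_format,
            of "t - r" T "1/2" ?\<phi> "\<lambda>s y. 2 * (-k) * (s - s0) + (-m)" "\<lambda>s y. (2 * (-l)) *\<^sub>R (y - y0)" t x x])
        (use C1 r min in auto)
    then show ?thesis
      using Jop_plus_Kop_quadratic[of \<alpha> r t T R u "-k" s0 "-m" "-l" y0 x] True \<alpha> r cont by simp
  next
    case False
    have "loc_min_QT T (\<lambda>s y. u s y - ?\<phi> s y) t x"
      unfolding loc_min_QT_def
    proof (intro exI[of _ "1/2"] conjI allI impI; (elim conjE)?)
      fix s y assume "s \<in> {0<..T}" "dist (s, y) (t, x) < 1/2"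
      then show "u s y - ?\<phi> s y \<ge> u t x - ?\<phi> t x"
        using min dist_snd_le[of "(s, y)" "(t, x)"] by (force simp: dist_commute)
    qed simp
    moreover have "C1_on T ?\<phi> (\<lambda>s y. 2 * (-k) * (s - s0) + (-m)) (\<lambda>s y. (2 * (-l)) *\<^sub>R (y - y0))"
      using C1 by (simp add: C1frac_def)
    ultimately have "2 * (-k) * (t - s0) + (-m) + H t x (u t x) ((2 * (-l)) *\<^sub>R (x - y0)) \<ge> 0"
      by (intro super[unfolded visc_super_def if_not_P[OF False], THEN conjunct2, THEN conjunct2, rule_format,
            of ?\<phi> "\<lambda>s y. 2 * (-k) * (s - s0) + (-m)" "\<lambda>s y. (2 * (-l)) *\<^sub>R (y - y0)" t x])
        (use r in auto)
    then show ?thesis using False \<alpha> r by (simp add: not_less)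
  qed
  also have "frac_op \<alpha> r R (2 * (-k) * (t - s0) + (-m)) (- (-k)) (\<lambda>\<tau>. u t x - u (max (t - \<tau>) 0) x)
    = - frac_op \<alpha> r R (2 * k * (t - s0) + m) (- k) (\<lambda>\<tau>. - u t x - - u (max (t - \<tau>) 0) x)"
    by (subst frac_op_uminus[symmetric]) simp
  finally show "frac_op \<alpha> r R (2 * k * (t - s0) + m) (- k) (\<lambda>\<tau>. - u t x - - u (max (t - \<tau>) 0) x)
       + dual_ham H t x (- u t x) ?p \<le> 0"
    by (simp add: dual_ham_def)
qed

section \<open>Periodic functions and the doubling maximum\<close>

lemma exists_int_vec_shift_into_unit_cube:
  fixes x :: "real^'d"
  obtains z where "int_vec z" "x + z \<in> cbox 0 1"
proof
  show "int_vec (\<chi> i. - of_int \<lfloor>x $ i\<rfloor>)" by (simp add: int_vec_def)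
  show "x + (\<chi> i. - of_int \<lfloor>x $ i\<rfloor>) \<in> cbox 0 1"
    unfolding mem_box_cart
  proof
    fix i
    have "of_int \<lfloor>x $ i\<rfloor> \<le> x $ i" "x $ i - of_int \<lfloor>x $ i\<rfloor> \<le> 1" by linarith+
    then show "0 $ i \<le> (x + (\<chi> i. - of_int \<lfloor>x $ i\<rfloor>)) $ i \<and> (x + (\<chi> i. - of_int \<lfloor>x $ i\<rfloor>)) $ i \<le> 1 $ i"
      by simp
  qed
qed

lemma periodic_uniformly_continuous:
  fixes u :: "real \<Rightarrow> real^'d \<Rightarrow> real"
  assumes cont: "continuous_on ({0..T} \<times> UNIV) (\<lambda>p. u (fst p) (snd p))"
    and per: "periodic_x u" and e: "0 < e"
  obtains d where "0 < d" "\<And>t s x y. \<lbrakk>t \<in> {0..T}; s \<in> {0..T}; \<bar>t - s\<bar> < d; norm (x - y) < d\<rbrakk>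
    \<Longrightarrow> \<bar>u t x - u s y\<bar> < e"
proof -
  \<comment> \<open>A point at distance less than 1 from the unit cube stays in this larger cube, so
    a single integer shift brings both points into one compact set.\<close>
  let ?S = "{0..T} \<times> cbox (-1) (1 + 1 :: real^'d)"
  have "uniformly_continuous_on ?S (\<lambda>p. u (fst p) (snd p))"
    by (intro compact_uniformly_continuous continuous_on_subset[OF cont] compact_Times) auto
  then obtain d where d: "d > 0" "\<And>p q. p \<in> ?S \<Longrightarrow> q \<in> ?S \<Longrightarrow> dist q p < d \<Longrightarrow>
      dist (u (fst q) (snd q)) (u (fst p) (snd p)) < e"
    unfolding uniformly_continuous_on_def using e by metis
  show thesis
  proof
    show "0 < min (d / 2) 1" using d by simp
  next
    fix t s and x y :: "real^'d"
    assume ts: "t \<in> {0..T}" "s \<in> {0..T}" "\<bar>t - s\<bar> < min (d / 2) 1" "norm (x - y) < min (d / 2) 1"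
    obtain z where z: "int_vec z" "x + z \<in> cbox 0 1"
      by (rule exists_int_vec_shift_into_unit_cube)
    have box: "0 \<le> x $ i + z $ i \<and> x $ i + z $ i \<le> 1" for i
      using z(2) by (simp add: mem_box_cart)
    have "-1 \<le> y $ i + z $ i \<and> y $ i + z $ i \<le> 2" for i
      using component_le_norm_cart[of "x - y" i] ts(4) box[of i] unfolding vector_minus_component
      by linarith
    then have "y + z \<in> cbox (-1) (1 + 1)"
      by (simp add: mem_box_cart)
    moreover have "-1 \<le> x $ i + z $ i \<and> x $ i + z $ i \<le> 2" for i
      using box[of i] by linarith
    then have "x + z \<in> cbox (-1) (1 + 1)"
      by (simp add: mem_box_cart)
    moreover have "dist (t, x + z) (s, y + z) < d"
    proof -
      have "dist (t, x + z) (s, y + z) \<le> \<bar>t - s\<bar> + norm (x - y)"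
        using sqrt_sum_squares_le_sum_abs[of "t - s" "norm (x - y)"]
        by (simp add: dist_Pair_Pair dist_norm norm_Pair)
      then show ?thesis using ts by simp
    qed
    ultimately have "dist (u t (x + z)) (u s (y + z)) < e"
      using d(2)[of "(s, y + z)" "(t, x + z)"] ts by simp
    then show "\<bar>u t x - u s y\<bar> < e"
      using per z(1) by (simp add: periodic_x_def dist_real_def)
  qed
qed

lemma periodic_bounded:
  fixes u :: "real \<Rightarrow> real^'d \<Rightarrow> real"
  assumes cont: "continuous_on ({0..T} \<times> UNIV) (\<lambda>p. u (fst p) (snd p))"
    and per: "periodic_x u"
  obtains M where "0 \<le> M" "\<And>t x. t \<in> {0..T} \<Longrightarrow> \<bar>u t x\<bar> \<le> M"
proof -
  let ?S = "{0..T} \<times> cbox 0 (1 :: real^'d)"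
  have "compact ((\<lambda>p. u (fst p) (snd p)) ` ?S)"
    by (intro compact_continuous_image continuous_on_subset[OF cont] compact_Times) auto
  from compact_imp_bounded[OF this]
  obtain M where M: "M > 0" "\<And>p. p \<in> ?S \<Longrightarrow> \<bar>u (fst p) (snd p)\<bar> \<le> M"
    by (force simp: bounded_pos)
  show thesis
  proof
    show "0 \<le> M" using M by simp
    fix t and x :: "real^'d" assume t: "t \<in> {0..T}"
    obtain z where z: "int_vec z" "x + z \<in> cbox 0 1"
      by (rule exists_int_vec_shift_into_unit_cube)
    then have "\<bar>u t (x + z)\<bar> \<le> M" using M(2)[of "(t, x + z)"] t by simp
    then show "\<bar>u t x\<bar> \<le> M" using per z(1) by (simp add: periodic_x_def)
  qed
qed

definition doubling :: "real \<Rightarrow> real \<Rightarrow> real \<Rightarrow> (real \<Rightarrow> real^'d \<Rightarrow> real) \<Rightarrow> (real \<Rightarrow> real^'d \<Rightarrow> real)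
    \<Rightarrow> real \<Rightarrow> real^'d \<Rightarrow> real \<Rightarrow> real^'d \<Rightarrow> real" where
  "doubling k m l u v t x s y =
     u t x - v s y - (k * (t - s)\<^sup>2 + m * t + l * (norm (x - y))\<^sup>2)"

text \<open>The constraint on x - y makes the problem compact modulo integer translations; for large l it is
  inactive at a maximum.\<close>
lemma doubling_max_exists:
  fixes u v :: "real \<Rightarrow> real^'d \<Rightarrow> real"
  assumes T: "0 \<le> T"
    and cu: "continuous_on ({0..T} \<times> UNIV) (\<lambda>p. u (fst p) (snd p))" and pu: "periodic_x u"
    and cv: "continuous_on ({0..T} \<times> UNIV) (\<lambda>p. v (fst p) (snd p))" and pv: "periodic_x v"
  obtains t x s y where "t \<in> {0..T}" "s \<in> {0..T}" "norm (x - y) \<le> 1"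
    "\<And>t' x' s' y'. \<lbrakk>t' \<in> {0..T}; s' \<in> {0..T}; norm (x' - y') \<le> 1\<rbrakk>
       \<Longrightarrow> doubling k m l u v t' x' s' y' \<le> doubling k m l u v t x s y"
proof -
  let ?\<Phi> = "doubling k m l u v"
  \<comment> \<open>The second space point is written as x + w: the same integer shift moves both
    points, so only x is reduced to the unit cube while w ranges over a ball.\<close>
  let ?S = "({0..T} \<times> cbox 0 (1 :: real^'d)) \<times> ({0..T} \<times> cball (0 :: real^'d) 1)"
  let ?F = "\<lambda>p. ?\<Phi> (fst (fst p)) (snd (fst p)) (fst (snd p)) (snd (fst p) + snd (snd p))"
  have 1: "continuous_on ?S (\<lambda>p. u (fst (fst p)) (snd (fst p)))"
    by (rule continuous_on_compose2[OF cu]) (auto intro!: continuous_intros)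
  have 2: "continuous_on ?S (\<lambda>p. v (fst (snd p)) (snd (fst p) + snd (snd p)))"
    by (rule continuous_on_compose2[OF cv, of _ "\<lambda>p. (fst (snd p), snd (fst p) + snd (snd p))", simplified])
      (auto intro!: continuous_intros)
  have "continuous_on ?S ?F"
    unfolding doubling_def by (intro continuous_intros 1 2)
  moreover have "compact ?S" by (intro compact_Times) auto
  moreover have "?S \<noteq> {}" using T by (simp add: interval_ne_empty_cart)
  ultimately obtain p where p: "p \<in> ?S" "\<And>q. q \<in> ?S \<Longrightarrow> ?F q \<le> ?F p"
    using continuous_attains_sup[of ?S ?F] by blast
  obtain t x s w where pe: "p = ((t, x), (s, w))" by (metis prod.collapse)
  show thesis
  proof
    show "t \<in> {0..T}" "s \<in> {0..T}" "norm (x - (x + w)) \<le> 1" using p pe by (auto)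
  next
    fix t' s' and x' y' :: "real^'d" assume *: "t' \<in> {0..T}" "s' \<in> {0..T}" "norm (x' - y') \<le> 1"
    obtain z where z: "int_vec z" "x' + z \<in> cbox 0 1"
      by (rule exists_int_vec_shift_into_unit_cube)
    have "?F ((t', x' + z), (s', y' - x')) \<le> ?F p"
      using * z by (intro p(2)) (auto simp: norm_minus_commute)
    moreover have "u t' (x' + z) = u t' x'" "v s' (y' + z) = v s' y'"
      using pu pv z(1) by (auto simp: periodic_x_def)
    moreover have "x' + z + (y' - x') = y' + z" by simp
    ultimately show "?\<Phi> t' x' s' y' \<le> ?\<Phi> t x s (x + w)"
      unfolding pe doubling_def by simp
  qed
qed

lemma periodic_ham_bounded:
  fixes H :: "real \<Rightarrow> real^'d \<Rightarrow> real \<Rightarrow> real^'d \<Rightarrow> real"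
  assumes per: "\<And>t x r p z. int_vec z \<Longrightarrow> H t (x + z) r p = H t x r p"
    and cont: "continuous_on ({0..T} \<times> UNIV \<times> UNIV \<times> UNIV) (\<lambda>(t, x, r, p). H t x r p)"
  obtains L where "0 \<le> L" "\<And>t x r p. \<lbrakk>t \<in> {0..T}; \<bar>r\<bar> \<le> M; norm p \<le> P\<rbrakk> \<Longrightarrow> \<bar>H t x r p\<bar> \<le> L"
proof -
  let ?S = "{0..T} \<times> cbox 0 (1 :: real^'d) \<times> {-M..M} \<times> cball (0 :: real^'d) P"
  have "compact ((\<lambda>(t, x, r, p). H t x r p) ` ?S)"
    by (intro compact_continuous_image continuous_on_subset[OF cont] compact_Times) auto
  from compact_imp_bounded[OF this]
  obtain L where L: "L > 0" "\<And>q. q \<in> ?S \<Longrightarrow> \<bar>(\<lambda>(t, x, r, p). H t x r p) q\<bar> \<le> L"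
    by (force simp: bounded_pos)
  show thesis
  proof
    show "0 \<le> L" using L by simp
    fix t r and x p :: "real^'d" assume *: "t \<in> {0..T}" "\<bar>r\<bar> \<le> M" "norm (p :: real^'d) \<le> P"
    obtain z where z: "int_vec z" "x + z \<in> cbox 0 1"
      by (rule exists_int_vec_shift_into_unit_cube)
    then have "\<bar>H t (x + z) r p\<bar> \<le> L" using L(2)[of "(t, x + z, r, p)"] * by (auto simp: abs_le_iff)
    then show "\<bar>H t x r p\<bar> \<le> L" using per z(1) by simp
  qed
qed

lemma periodic_ham_uniformly_continuous_time:
  fixes H :: "real \<Rightarrow> real^'d \<Rightarrow> real \<Rightarrow> real^'d \<Rightarrow> real"
  assumes per: "\<And>t x r p z. int_vec z \<Longrightarrow> H t (x + z) r p = H t x r p"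
    and cont: "continuous_on ({0..T} \<times> UNIV \<times> UNIV \<times> UNIV) (\<lambda>(t, x, r, p). H t x r p)"
    and e: "0 < e"
  obtains d where "0 < d" "\<And>t s x r p. \<lbrakk>t \<in> {0..T}; s \<in> {0..T}; \<bar>t - s\<bar> < d; \<bar>r\<bar> \<le> M; norm p \<le> P\<rbrakk>
     \<Longrightarrow> \<bar>H t x r p - H s x r p\<bar> < e"
proof -
  let ?S = "{0..T} \<times> cbox 0 (1 :: real^'d) \<times> {-M..M} \<times> cball (0 :: real^'d) P"
  let ?H = "\<lambda>(t, x, r, p). H t x r p"
  have "uniformly_continuous_on ?S ?H"
    by (intro compact_uniformly_continuous continuous_on_subset[OF cont] compact_Times) auto
  then obtain d where d: "d > 0" "\<And>p q. p \<in> ?S \<Longrightarrow> q \<in> ?S \<Longrightarrow> dist q p < d \<Longrightarrow> dist (?H q) (?H p) < e"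
    unfolding uniformly_continuous_on_def using e by metis
  show thesis
  proof
    show "0 < d" by (rule d)
    fix t s r and x p :: "real^'d" assume *: "t \<in> {0..T}" "s \<in> {0..T}" "\<bar>t - s\<bar> < d" "\<bar>r\<bar> \<le> M" "norm (p :: real^'d) \<le> P"
    obtain z where z: "int_vec z" "x + z \<in> cbox 0 1"
      by (rule exists_int_vec_shift_into_unit_cube)
    have "dist (?H (t, x + z, r, p)) (?H (s, x + z, r, p)) < e"
      by (rule d(2)) (use * z in \<open>auto simp: dist_Pair_Pair dist_real_def\<close>)
    then show "\<bar>H t x r p - H s x r p\<bar> < e" using per z(1) by (simp add: dist_real_def)
  qed
qed

section \<open>Bound near the initial time\<close>

text \<open>Continuity and positivity on the compact range [1,2] make the bound uniform in the
  order.\<close>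

lemma rGamma_lower_bound:
  obtains c where "0 < c" "\<And>\<alpha>. \<alpha> \<in> {0..1} \<Longrightarrow> c \<le> rGamma (2 - \<alpha> :: real)"
proof -
  obtain x :: real where x: "x \<in> {1..2}" "\<And>y. y \<in> {1..2} \<Longrightarrow> rGamma x \<le> rGamma y"
    using continuous_attains_inf[OF compact_Icc _ continuous_on_rGamma, of 1 "2::real"] by force
  show thesis
    by (rule that[of "rGamma x"]) (use x in \<open>auto intro: rGamma_pos\<close>)
qed

text \<open>A linear function of time is a barrier uniformly in the order: as t tends to 0 its Caputo derivative
  may vanish, but then the jump w at the initial time dominates, and Young's inequality with weights
  \<open>\<alpha>\<close> and \<open>1 - \<alpha>\<close> makes the powers of t cancel.\<close>
lemma linear_barrier_bound:
  fixes G a t w D \<alpha> :: real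
  assumes \<alpha>: "0 < \<alpha>" "\<alpha> < 1" and t: "0 < t" and a: "0 < a" "a \<le> w" and D: "1 \<le> D" and G: "0 \<le> G"
  shows "G * a * D powr \<alpha>
    \<le> \<alpha> * G * (a * D) * t powr (1 - \<alpha>) + ((1 - \<alpha>) * G) * w * t powr (- \<alpha>)"
proof -
  have "D powr \<alpha> = (D * t powr (1 - \<alpha>)) powr \<alpha> * (t powr (- \<alpha>)) powr (1 - \<alpha>)"
  proof -
    have "t powr ((1 - \<alpha>) * \<alpha>) * t powr (- \<alpha> * (1 - \<alpha>)) = t powr ((1 - \<alpha>) * \<alpha> + - \<alpha> * (1 - \<alpha>))"
      by (rule powr_add[symmetric])
    also have "(1 - \<alpha>) * \<alpha> + - \<alpha> * (1 - \<alpha>) = 0" by (simp add: algebra_simps)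
    finally have "t powr ((1 - \<alpha>) * \<alpha>) * t powr (- \<alpha> * (1 - \<alpha>)) = 1" using t by simp
    then show ?thesis using t D by (simp add: powr_mult powr_powr mult.assoc)
  qed
  also have "\<dots> \<le> \<alpha> * (D * t powr (1 - \<alpha>)) + (1 - \<alpha>) * t powr (- \<alpha>)"
    using \<alpha> t D by (intro Youngs_inequality_0) auto
  finally have "(G * a) * D powr \<alpha> \<le> (G * a) * (\<alpha> * (D * t powr (1 - \<alpha>)) + (1 - \<alpha>) * t powr (- \<alpha>))"
    using G a by (intro mult_left_mono) auto
  also have "\<dots> = \<alpha> * G * (a * D) * t powr (1 - \<alpha>) + ((1 - \<alpha>) * G) * a * t powr (- \<alpha>)"
    by (simp add: algebra_simps)
  also have "\<dots> \<le> \<alpha> * G * (a * D) * t powr (1 - \<alpha>) + ((1 - \<alpha>) * G) * w * t powr (- \<alpha>)"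
    using a G \<alpha> by (intro add_left_mono mult_right_mono mult_left_mono) auto
  finally show ?thesis .
qed

text \<open>Doubling against the time-independent function \<open>u0\<close>, without time penalty:
  if the slope of the barrier is large, the subsolution inequality fails at a maximum. The slope
  depends on \<open>u0\<close>, \<open>H\<close>, \<open>\<alpha>0\<close> and \<open>\<eta>\<close>
  but neither on the order nor on \<open>u\<close>.\<close>

lemma initial_layer_bound:
  fixes H :: "real \<Rightarrow> real^'d \<Rightarrow> real \<Rightarrow> real^'d \<Rightarrow> real"
  assumes T: "0 < T"
    and per: "\<And>t x r p z. int_vec z \<Longrightarrow> H t (x + z) r p = H t x r p"
    and cont: "continuous_on ({0..T} \<times> UNIV \<times> UNIV \<times> UNIV) (\<lambda>(t, x, r, p). H t x r p)"
    and mono: "\<And>t x r s p. \<lbrakk>t \<in> {0..T}; r \<le> s\<rbrakk> \<Longrightarrow> H t x r p \<le> H t x s p"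
    and u0: "continuous_on UNIV u0" "periodic_fn u0"
    and \<alpha>0: "0 < \<alpha>0" and \<eta>: "0 < \<eta>"
  obtains C where "0 < C" "\<And>\<alpha> u t x. \<lbrakk>\<alpha>0 \<le> \<alpha>; \<alpha> < 1; quad_subsol \<alpha> T H u; periodic_x u;
      continuous_on ({0..T} \<times> UNIV) (\<lambda>p. u (fst p) (snd p)); \<And>x. u 0 x = u0 x; t \<in> {0..T}\<rbrakk>
      \<Longrightarrow> u t x \<le> u0 x + \<eta> + C * t"
proof -
  define v where "v = (\<lambda>s::real. u0)"
  have cv: "continuous_on ({0..T} \<times> UNIV) (\<lambda>p. v (fst p) (snd p))"
    unfolding v_def by (rule continuous_on_compose2[OF u0(1)]) (auto intro!: continuous_intros)
  have pv: "periodic_x v" using u0(2) by (simp add: v_def periodic_x_def periodic_fn_def)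
  obtain M where M: "0 \<le> M" "\<And>x. \<bar>u0 x\<bar> \<le> M"
    using periodic_bounded[OF cv pv] T unfolding v_def by (metis atLeastAtMost_iff less_imp_le order_refl)
  obtain d0 where d0: "0 < d0" "\<And>x y. norm (x - y) < d0 \<Longrightarrow> \<bar>u0 x - u0 y\<bar> < \<eta> / 2"
  proof (rule periodic_uniformly_continuous[OF cv pv, of "\<eta> / 2"])
    fix d assume "0 < d" "\<And>t s x y. \<lbrakk>t \<in> {0..T}; s \<in> {0..T}; \<bar>t - s\<bar> < d; norm (x - y) < d\<rbrakk>
       \<Longrightarrow> \<bar>v t x - v s y\<bar> < \<eta> / 2"
    from this(1) this(2)[of 0 0] show thesis using T by (intro that[of d]) (auto simp: v_def)
  qed (use \<eta> in simp)
  define d where "d = min d0 (1/2)"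
  have d: "0 < d" "d \<le> d0" "d \<le> 1/2" using d0 by (auto simp: d_def)
  \<comment> \<open>Replacing y by x at a maximum bounds the penalty by u0 x - u0 y \<le> 2 M < l
    d^2, which forces |x - y| < d.\<close>
  define l where "l = (2 * M + 1) / d\<^sup>2"
  have l: "0 < l" using M d by (simp add: l_def)
  obtain L where L: "0 \<le> L" "\<And>t x r p. \<lbrakk>t \<in> {0..T}; \<bar>r\<bar> \<le> M; norm p \<le> 2 * l * d\<rbrakk> \<Longrightarrow> \<bar>H t x r p\<bar> \<le> L"
    using periodic_ham_bounded[OF per cont] by metis
  obtain c where c: "0 < c" "\<And>\<alpha>. \<alpha> \<in> {0..1} \<Longrightarrow> c \<le> rGamma (2 - \<alpha> :: real)"
    by (rule rGamma_lower_bound) blast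
  \<comment> \<open>Solves c (\<eta>/2) D^\<alpha>0 = L + c \<eta>, which exceeds the bound L of the
    Hamiltonian; since D \<ge> 1, larger orders only increase the power.\<close>
  define D where "D = (1 + 2 * L / (c * \<eta>) + 1) powr (1 / \<alpha>0)"
  have D1: "1 \<le> D" unfolding D_def using L c \<eta> \<alpha>0 by (intro ge_one_powr_ge_zero) auto
  have "D powr \<alpha>0 = 1 + 2 * L / (c * \<eta>) + 1"
    unfolding D_def using \<alpha>0 L c \<eta> by (simp add: powr_powr add_nonneg_pos)
  then have "c * (\<eta> / 2) * D powr \<alpha>0 = c * \<eta> + L"
    using c \<eta> by (simp add: field_simps)
  then have DL: "L < c * (\<eta> / 2) * D powr \<alpha>0" using c \<eta> by simp
  show thesis
  proof
    show "0 < \<eta> / 2 * D" using D1 \<eta> by simp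
  next
    fix \<alpha> u t x
    assume \<alpha>: "\<alpha>0 \<le> \<alpha>" "\<alpha> < 1" and sub: "quad_subsol \<alpha> T H u" and pu: "periodic_x u"
      and cu: "continuous_on ({0..T} \<times> UNIV) (\<lambda>p. u (fst p) (snd p))"
      and init: "\<And>x. u 0 x = u0 x" and t: "t \<in> {0..T}"
    define C where "C = \<eta> / 2 * D"
    have C: "0 < C" using D1 \<eta> by (simp add: C_def)
    show "u t x \<le> u0 x + \<eta> + \<eta> / 2 * D * t"
    proof (rule ccontr)
      assume "\<not> ?thesis"
      then have big: "u t x > u0 x + \<eta> + C * t" by (simp add: C_def)
      obtain t' x' s' y' where mx: "t' \<in> {0..T}" "s' \<in> {0..T}" "norm (x' - y') \<le> 1"
        and max: "\<And>t x s y. \<lbrakk>t \<in> {0..T}; s \<in> {0..T}; norm (x - y) \<le> 1\<rbrakk>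
          \<Longrightarrow> doubling 0 C l u v t x s y \<le> doubling 0 C l u v t' x' s' y'"
        by (rule doubling_max_exists[OF less_imp_le[OF T] cu pu cv pv, of 0 C l]) blast
      have val: "u t' x' - u0 y' - (C * t' + l * (norm (x' - y'))\<^sup>2) > \<eta>"
        using max[OF t t, of x x] big by (simp add: doubling_def v_def)
      have "l * (norm (x' - y'))\<^sup>2 \<le> u0 x' - u0 y'"
        using max[OF mx(1,2), of x' x'] by (simp add: doubling_def v_def)
      also have "\<dots> < l * d\<^sup>2"
        using M(2)[of x'] M(2)[of y'] d unfolding l_def by simp
      finally have nd: "norm (x' - y') < d"
        using l d by (simp add: power_less_imp_less_base)
      then have uu: "\<bar>u0 x' - u0 y'\<bar> < \<eta> / 2" using d0(2) d by simp
      have lnn: "0 \<le> l * (norm (x' - y'))\<^sup>2" using l by simp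
      have "t' \<noteq> 0"
        using val uu lnn init \<eta> by (intro notI) (simp add: abs_less_iff)
      then have t': "0 < t'" "t' \<le> T" using mx by auto
      let ?g = "\<lambda>\<tau>. u t' x' - u (max (t' - \<tau>) 0) x'"
      let ?p = "(2 * l) *\<^sub>R (x' - y')"
      \<comment> \<open>With r = R = t' the integral in K is over a point, and only the jump from
        the initial value remains.\<close>
      have "frac_op \<alpha> t' t' (2 * 0 * (t' - 0) + C) (- 0) ?g + H t' x' (u t' x') ?p \<le> 0"
      proof (rule quad_subsolD[OF sub])
        fix s y assume s: "s \<in> {0..T}" and y: "y \<in> cball x' (1/2)"
        have "norm (y - y') \<le> norm (y - x') + norm (x' - y')"
          using norm_triangle_ineq[of "y - x'" "x' - y'"] by simp
        also have "\<dots> \<le> 1" using y nd d by (simp add: dist_norm norm_minus_commute)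
        finally show "u s y - (0 * (s - 0)\<^sup>2 + C * s + l * (norm (y - y'))\<^sup>2)
          \<le> u t' x' - (0 * (t' - 0)\<^sup>2 + C * t' + l * (norm (x' - y'))\<^sup>2)"
          using max[OF s mx(2), of y y'] by (simp add: doubling_def)
      qed (use t' in auto)
      then have eq: "frac_op \<alpha> t' t' C 0 ?g \<le> - H t' x' (u t' x') ?p" by simp
      have w: "\<eta> / 2 \<le> u t' x' - u0 x'"
      proof -
        have "0 \<le> C * t'" using C t' by simp
        then show ?thesis using val uu lnn by linarith
      qed
      have "frac_op \<alpha> t' t' C 0 ?g = \<alpha> * rGamma (2 - \<alpha>) * (\<eta> / 2 * D) * t' powr (1 - \<alpha>)
          + ((1 - \<alpha>) * rGamma (2 - \<alpha>)) * (u t' x' - u0 x') * t' powr (- \<alpha>)"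
        by (simp add: frac_op_def init C_def rGamma_one_minus[of \<alpha>])
      also have "\<dots> \<ge> rGamma (2 - \<alpha>) * (\<eta> / 2) * D powr \<alpha>"
        using \<alpha> \<alpha>0 t' \<eta> w D1 by (intro linear_barrier_bound) (auto intro: rGamma_nonneg)
      also have "rGamma (2 - \<alpha>) * (\<eta> / 2) * D powr \<alpha> \<ge> c * (\<eta> / 2) * D powr \<alpha>0"
        using c \<alpha> \<alpha>0 \<eta> D1 by (intro mult_mono powr_mono) (auto intro!: mult_nonneg_nonneg rGamma_nonneg)
      finally have "L < - H t' x' (u t' x') ?p" using DL eq by linarith
      \<comment> \<open>There is no upper bound on \<open>u\<close> independent of \<open>u\<close>
        at this stage; a lower bound suffices, because monotonicity in r allows passing to the value
        -M.\<close>
      moreover have "- M \<le> u t' x'"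
        using w M(2)[of x'] \<eta> by (simp add: abs_le_iff)
      then have "H t' x' (- M) ?p \<le> H t' x' (u t' x') ?p"
        using mx by (intro mono) auto
      moreover have "\<bar>H t' x' (- M) ?p\<bar> \<le> L"
        using mx M l nd by (intro L(2)) auto
      ultimately show False by linarith
    qed
  qed
qed

section \<open>Dependence of the operator on the order\<close>

lemma integrable_powr_kernel:
  fixes g :: "real \<Rightarrow> real"
  assumes "0 < r" "continuous_on {r..R} g"
  shows "(\<lambda>\<tau>. g \<tau> * \<tau> powr (- \<alpha> - 1)) integrable_on {r..R}"
  using assms by (intro integrable_continuous_real continuous_intros) auto

lemma frac_op_add_scaled:
  assumes "0 < r" "continuous_on {r..R} g" "continuous_on {r..R} h"
  shows "frac_op \<alpha> r R (A + m * A') (B + m * B') (\<lambda>\<tau>. g \<tau> + m * h \<tau>)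
    = frac_op \<alpha> r R A B g + m * frac_op \<alpha> r R A' B' h"
proof -
  have "integral {r..R} (\<lambda>\<tau>. (g \<tau> + m * h \<tau>) * \<tau> powr (- \<alpha> - 1))
     = integral {r..R} (\<lambda>\<tau>. g \<tau> * \<tau> powr (- \<alpha> - 1) + m * (h \<tau> * \<tau> powr (- \<alpha> - 1)))"
    by (simp add: algebra_simps)
  also have "\<dots> = integral {r..R} (\<lambda>\<tau>. g \<tau> * \<tau> powr (- \<alpha> - 1))
       + m * integral {r..R} (\<lambda>\<tau>. h \<tau> * \<tau> powr (- \<alpha> - 1))"
    using integrable_powr_kernel[OF assms(1,2)] integrable_powr_kernel[OF assms(1,3)]
    by (simp add: integral_add integrable_on_mult_right)
  finally show ?thesis
    unfolding frac_op_def by (simp add: algebra_simps add_divide_distrib)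
qed

text \<open>Ellipticity: \<open>rGamma (1 - \<alpha>)\<close> is nonnegative for orders in [0,1],
  hence so are all weights on the past increments.\<close>

lemma frac_op_mono:
  assumes "\<alpha> \<in> {0..1}" "0 < r" "r \<le> R" "continuous_on {r..R} g" "continuous_on {r..R} h"
    and le: "\<And>\<tau>. \<tau> \<in> {r..R} \<Longrightarrow> g \<tau> \<le> h \<tau>"
  shows "frac_op \<alpha> r R A B g \<le> frac_op \<alpha> r R A B h"
proof -
  have "0 \<le> rGamma (1 - \<alpha>)"
    using assms(1) by (intro rGamma_nonneg) simp
  moreover have "integral {r..R} (\<lambda>\<tau>. g \<tau> * \<tau> powr (- \<alpha> - 1)) \<le> integral {r..R} (\<lambda>\<tau>. h \<tau> * \<tau> powr (- \<alpha> - 1))"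
    by (intro integral_le integrable_powr_kernel assms mult_right_mono le) auto
  moreover have "g R \<le> h R" using le assms by auto
  ultimately show ?thesis
    unfolding frac_op_def using assms(1)
    by (intro add_mono order_refl mult_left_mono mult_right_mono) auto
qed

text \<open>Since r > 0, the kernel with its prefactor is jointly continuous on the compact set
  \<open>{0..1} \<times> {r..R}\<close>. The error therefore depends on A and g only through their
  bounds, as needed for maximum points that move with the order.\<close>

lemma frac_op_continuous_in_order:
  assumes r: "0 < r" "r \<le> R" and \<beta>: "\<beta> \<in> {0..1}" and e: "0 < e"
  shows "\<forall>\<^sub>F \<alpha> in at \<beta> within {0..1}. \<forall>A g. \<bar>A\<bar> \<le> Q \<and> continuous_on {r..R} g \<and> (\<forall>\<tau>\<in>{r..R}. \<bar>g \<tau>\<bar> \<le> N) \<longrightarrow>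
    \<bar>frac_op \<alpha> r R A B g - frac_op \<beta> r R A B g\<bar> \<le> e"
proof (cases "0 \<le> Q \<and> 0 \<le> N")
  case False
  have "Q < 0 \<or> N < 0" using False by auto
  then show ?thesis using r by (intro always_eventually) force
next
  case True
  define a where "a = (\<lambda>\<alpha>::real. \<alpha> * rGamma (2 - \<alpha>) * r powr (1 - \<alpha>))"
  define b where "b = (\<lambda>\<alpha>::real. \<alpha> * rGamma (1 - \<alpha>) * B * r powr (2 - \<alpha>) / (2 - \<alpha>))"
  define c where "c = (\<lambda>\<alpha>::real. rGamma (1 - \<alpha>) * R powr (- \<alpha>))"
  define f where "f = (\<lambda>(\<alpha>::real) \<tau>. \<alpha> * rGamma (1 - \<alpha>) * \<tau> powr (- \<alpha> - 1))"
  \<comment> \<open>The summands account for the linear coefficient, the quadratic coefficient, the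
    boundary term and the integral, each with an error of e' in its weight.\<close>
  define K where "K = Q + 1 + N + N * (R - r)"
  have "0 \<le> N * (R - r)" using True r by simp
  then have K: "0 < K" using True by (simp add: K_def)
  define e' where "e' = e / K"
  have e': "0 < e'" using e K by (simp add: e'_def)
  have rg: "continuous_on S (\<lambda>p. rGamma (h p))" if "continuous_on S h" for S and h :: "'z::topological_space \<Rightarrow> real"
    using continuous_on_compose2[OF continuous_on_rGamma[of UNIV] that] by simp
  have near: "\<forall>\<^sub>F \<alpha> in at \<beta> within {0..1}. \<bar>q \<alpha> - q \<beta>\<bar> < e'" if "continuous_on {0..1} q" for q :: "real \<Rightarrow> real"
    using that \<beta> e' by (auto simp: continuous_on_def tendsto_iff dist_real_def)
  have ca: "continuous_on {0..1} a" "continuous_on {0..1} b" "continuous_on {0..1} c"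
    unfolding a_def b_def c_def using r by (auto intro!: continuous_intros rg)
  have "continuous_on ({0..1} \<times> {r..R}) (\<lambda>p. f (fst p) (snd p))"
    unfolding f_def using r by (auto intro!: continuous_intros rg)
  then have "uniformly_continuous_on ({0..1} \<times> {r..R}) (\<lambda>p. f (fst p) (snd p))"
    by (intro compact_uniformly_continuous compact_Times) auto
  then obtain \<delta> where \<delta>: "0 < \<delta>" "\<And>p q. \<lbrakk>p \<in> {0..1} \<times> {r..R}; q \<in> {0..1} \<times> {r..R}; dist q p < \<delta>\<rbrakk>
      \<Longrightarrow> dist (f (fst q) (snd q)) (f (fst p) (snd p)) < e'"
    unfolding uniformly_continuous_on_def using e' by metis
  have "\<forall>\<^sub>F \<alpha> in at \<beta> within {0..1}. \<alpha> \<in> {0..1} \<and> dist \<alpha> \<beta> < \<delta>"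
    using \<delta>(1) by (auto simp: eventually_at)
  from this near[OF ca(1)] near[OF ca(2)] near[OF ca(3)] show ?thesis
  proof eventually_elim
    case (elim \<alpha>)
    show ?case
    proof (intro allI impI, elim conjE)
      fix A g
      assume A: "\<bar>A\<bar> \<le> Q" and g: "continuous_on {r..R} g" "\<forall>\<tau>\<in>{r..R}. \<bar>g \<tau>\<bar> \<le> N"
      have op: "frac_op \<gamma> r R A B g = A * a \<gamma> + b \<gamma> + integral {r..R} (\<lambda>\<tau>. g \<tau> * f \<gamma> \<tau>) + g R * c \<gamma>" for \<gamma>
        unfolding frac_op_def a_def b_def c_def f_def
        by (subst integral_mult_right[symmetric]) (simp add: mult_ac)
      have fi: "(\<lambda>\<tau>. g \<tau> * f \<gamma> \<tau>) integrable_on {r..R}" for \<gamma>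
        unfolding f_def using r by (intro integrable_continuous_real continuous_intros g) auto
      have "norm (integral {r..R} (\<lambda>\<tau>. g \<tau> * f \<alpha> \<tau> - g \<tau> * f \<beta> \<tau>)) \<le> N * e' * (R - r)"
      proof (rule integral_bound)
        show "continuous_on {r..R} (\<lambda>\<tau>. g \<tau> * f \<alpha> \<tau> - g \<tau> * f \<beta> \<tau>)"
          unfolding f_def using r by (intro continuous_intros g) auto
        fix \<tau> assume \<tau>: "\<tau> \<in> {r..R}"
        have "\<bar>f \<alpha> \<tau> - f \<beta> \<tau>\<bar> \<le> e'"
          using \<delta>(2)[of "(\<beta>, \<tau>)" "(\<alpha>, \<tau>)"] \<tau> elim \<beta> by (simp add: dist_Pair_Pair dist_real_def)
        then have "\<bar>g \<tau>\<bar> * \<bar>f \<alpha> \<tau> - f \<beta> \<tau>\<bar> \<le> N * e'"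
          using g(2) \<tau> True by (intro mult_mono) auto
        then show "norm (g \<tau> * f \<alpha> \<tau> - g \<tau> * f \<beta> \<tau>) \<le> N * e'"
          by (simp add: abs_mult flip: right_diff_distrib)
      qed (use r in simp)
      then have 1: "\<bar>integral {r..R} (\<lambda>\<tau>. g \<tau> * f \<alpha> \<tau>) - integral {r..R} (\<lambda>\<tau>. g \<tau> * f \<beta> \<tau>)\<bar> \<le> N * e' * (R - r)"
        using fi by (simp add: integral_diff)
      have "\<bar>A\<bar> * \<bar>a \<alpha> - a \<beta>\<bar> \<le> Q * e'"
        using A elim True by (intro mult_mono) auto
      then have 2: "\<bar>A * a \<alpha> - A * a \<beta>\<bar> \<le> Q * e'"
        by (simp add: abs_mult flip: right_diff_distrib)
      have "\<bar>g R\<bar> * \<bar>c \<alpha> - c \<beta>\<bar> \<le> N * e'"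
        using g(2) r elim True by (intro mult_mono) auto
      then have 3: "\<bar>g R * c \<alpha> - g R * c \<beta>\<bar> \<le> N * e'"
        by (simp add: abs_mult flip: right_diff_distrib)
      have "\<bar>frac_op \<alpha> r R A B g - frac_op \<beta> r R A B g\<bar> \<le> Q * e' + e' + N * e' * (R - r) + N * e'"
        using 1 2 3 elim unfolding op by linarith
      also have "\<dots> = K * e'" by (simp add: K_def algebra_simps)
      also have "\<dots> = e" using K by (simp add: e'_def)
      finally show "\<bar>frac_op \<alpha> r R A B g - frac_op \<beta> r R A B g\<bar> \<le> e" .
    qed
  qed
qed

section \<open>Comparison of solutions of different orders\<close>

lemma continuous_on_backward:
  fixes u :: "real \<Rightarrow> real^'d \<Rightarrow> real"
  assumes cont: "continuous_on ({0..T} \<times> UNIV) (\<lambda>p. u (fst p) (snd p))"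
    and "t \<in> {0..T}" "0 \<le> r"
  shows "continuous_on {r..R} (\<lambda>\<tau>. u t x - u (max (t - \<tau>) 0) x)"
  by (intro continuous_intros
      continuous_on_compose2[OF cont, of _ "\<lambda>\<tau>. (max (t - \<tau>) 0, x)", simplified fst_conv snd_conv])
    (use assms in auto)

text \<open>Moving both times of the maximum point back by the same amount (and stopping at 0) does not
  increase their distance, so the increments of u dominate those of v plus those of m t.\<close>
lemma doubling_max_inequality:
  fixes u v :: "real \<Rightarrow> real^'d \<Rightarrow> real"
  assumes u: "quad_subsol \<alpha> T H u" "continuous_on ({0..T} \<times> UNIV) (\<lambda>p. u (fst p) (snd p))"
    and v: "quad_subsol \<beta> T (dual_ham H) (\<lambda>s y. - v s y)"
      "continuous_on ({0..T} \<times> UNIV) (\<lambda>p. v (fst p) (snd p))"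
    and \<alpha>: "\<alpha> \<in> {0..1}" and k: "0 \<le> k" and r: "0 < r" "r \<le> t" "r \<le> s"
    and pt: "t \<in> {0..T}" "s \<in> {0..T}" "norm (x - y) \<le> 1/2"
    and max: "\<And>t' x' s' y'. \<lbrakk>t' \<in> {0..T}; s' \<in> {0..T}; norm (x' - y') \<le> 1\<rbrakk>
          \<Longrightarrow> doubling k m l u v t' x' s' y' \<le> doubling k m l u v t x s y"
  defines "g \<equiv> \<lambda>\<tau>. v s y - v (max (s - \<tau>) 0) y"
  shows "frac_op \<alpha> r T (2 * k * (t - s)) (- k) g + m * frac_op \<alpha> r T 1 0 (\<lambda>\<tau>. min \<tau> t)
      - frac_op \<beta> r T (2 * k * (t - s)) k g
    \<le> H s y (v s y) ((2 * l) *\<^sub>R (x - y)) - H t x (u t x) ((2 * l) *\<^sub>R (x - y))"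
proof -
  let ?p = "(2 * l) *\<^sub>R (x - y)"
  let ?f = "\<lambda>\<tau>. u t x - u (max (t - \<tau>) 0) x"
  have sub: "frac_op \<alpha> r T (2 * k * (t - s) + m) (- k) ?f + H t x (u t x) ?p \<le> 0"
  proof (rule quad_subsolD[OF u(1)])
    fix t' x' assume *: "t' \<in> {0..T}" "x' \<in> cball x (1/2)"
    have "norm (x' - y) \<le> norm (x' - x) + norm (x - y)"
      using norm_triangle_ineq[of "x' - x" "x - y"] by simp
    also have "\<dots> \<le> 1" using * pt by (simp add: dist_norm norm_minus_commute)
    finally show "u t' x' - (k * (t' - s)\<^sup>2 + m * t' + l * (norm (x' - y))\<^sup>2)
        \<le> u t x - (k * (t - s)\<^sup>2 + m * t + l * (norm (x - y))\<^sup>2)"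
      using max[of t' s x' y] * pt by (simp add: doubling_def)
  qed (use r pt in auto)
  \<comment> \<open>Here (t, x) is frozen, so the term m t is a constant, and the gradient in y of
    the penalty is the negative of \<open>?p\<close>.\<close>
  have "frac_op \<beta> r T (2 * k * (s - t) + 0) (- k) (\<lambda>\<tau>. - v s y - - v (max (s - \<tau>) 0) y)
       + dual_ham H s y (- v s y) ((2 * l) *\<^sub>R (y - x)) \<le> 0"
  proof (rule quad_subsolD[OF v(1)])
    fix s' y' assume *: "s' \<in> {0..T}" "y' \<in> cball y (1/2)"
    have "norm (x - y') \<le> norm (x - y) + norm (y - y')"
      using norm_triangle_ineq[of "x - y" "y - y'"] by simp
    also have "\<dots> \<le> 1" using * pt by (simp add: dist_norm)
    finally show "- v s' y' - (k * (s' - t)\<^sup>2 + 0 * s' + l * (norm (y' - x))\<^sup>2)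
        \<le> - v s y - (k * (s - t)\<^sup>2 + 0 * s + l * (norm (y - x))\<^sup>2)"
      using max[of t s' x y'] * pt
      by (simp add: doubling_def norm_minus_commute power2_commute[of t])
  qed (use r pt in auto)
  moreover have "frac_op \<beta> r T (2 * k * (s - t) + 0) (- k) (\<lambda>\<tau>. - v s y - - v (max (s - \<tau>) 0) y)
      = - frac_op \<beta> r T (2 * k * (t - s)) k g"
    by (subst frac_op_uminus[symmetric]) (simp add: g_def algebra_simps)
  moreover have "dual_ham H s y (- v s y) ((2 * l) *\<^sub>R (y - x)) = - H s y (v s y) ?p"
    by (simp add: dual_ham_def flip: scaleR_minus_right)
  ultimately have super: "frac_op \<beta> r T (2 * k * (t - s)) k g + H s y (v s y) ?p \<ge> 0"
    by simp
  have cg: "continuous_on {r..T} g"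
    unfolding g_def using pt r by (intro continuous_on_backward[OF v(2)]) auto
  \<comment> \<open>The function m t, frozen before time 0, has increments m min(tau, t); on [0,r]
    with r \<le> t they are linear, which gives slope m in the J-part.\<close>
  have "frac_op \<alpha> r T (2 * k * (t - s)) (- k) g + m * frac_op \<alpha> r T 1 0 (\<lambda>\<tau>. min \<tau> t)
      = frac_op \<alpha> r T (2 * k * (t - s) + m) (- k) (\<lambda>\<tau>. g \<tau> + m * min \<tau> t)"
    by (subst frac_op_add_scaled[where A' = 1 and B' = 0, simplified, symmetric])
      (use r cg in \<open>auto intro!: continuous_intros\<close>)
  also have "\<dots> \<le> frac_op \<alpha> r T (2 * k * (t - s) + m) (- k) ?f"
  proof (rule frac_op_mono)
    show "continuous_on {r..T} ?f"
      using pt r by (intro continuous_on_backward[OF u(2)]) auto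
    fix \<tau> assume \<tau>: "\<tau> \<in> {r..T}"
    let ?t = "max (t - \<tau>) 0" and ?s = "max (s - \<tau>) 0"
    have "doubling k m l u v ?t x ?s y \<le> doubling k m l u v t x s y"
      using pt r \<tau> by (intro max) auto
    moreover have "(?t - ?s)\<^sup>2 \<le> (t - s)\<^sup>2"
      unfolding abs_le_square_iff[symmetric] by linarith
    then have "k * (?t - ?s)\<^sup>2 \<le> k * (t - s)\<^sup>2"
      using k by (rule mult_left_mono)
    moreover have "m * t - m * ?t = m * min \<tau> t"
      by (auto simp: max_def min_def algebra_simps)
    ultimately show "g \<tau> + m * min \<tau> t \<le> ?f \<tau>"
      unfolding doubling_def g_def by linarith
  qed (use \<alpha> r pt cg in \<open>auto intro!: continuous_intros\<close>)
  finally show ?thesis using sub super by linarith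
qed

text \<open>Measures the strict gap produced by the term m t, uniformly in r because r is fixed only
  later. At order 1 the value is 1; below order 1 the boundary term of K alone is positive and does
  not involve r.\<close>

lemma frac_op_linear_lower_bound:
  assumes \<beta>: "\<beta> \<in> {0<..1}" and t: "0 < t" "t \<le> T"
  obtains c where "0 < c" "\<And>r. \<lbrakk>0 < r; r \<le> t\<rbrakk> \<Longrightarrow> c \<le> frac_op \<beta> r T 1 0 (\<lambda>\<tau>. min \<tau> t)"
proof (cases "\<beta> = 1")
  case True
  then show thesis by (intro that[of 1]) auto
next
  case False
  let ?c = "rGamma (1 - \<beta>) * t * T powr (- \<beta>)"
  have "?c \<le> frac_op \<beta> r T 1 0 (\<lambda>\<tau>. min \<tau> t)" if r: "0 < r" "r \<le> t" for r
  proof -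
    have "0 \<le> \<beta> * rGamma (2 - \<beta>) * 1 * r powr (1 - \<beta>)"
      using \<beta> by (auto intro!: mult_nonneg_nonneg rGamma_nonneg)
    moreover have "0 \<le> \<beta> * rGamma (1 - \<beta>) * integral {r..T} (\<lambda>\<tau>. min \<tau> t * \<tau> powr (- \<beta> - 1))"
      using \<beta> r t by (auto intro!: mult_nonneg_nonneg rGamma_nonneg Henstock_Kurzweil_Integration.integral_nonneg
          integrable_powr_kernel continuous_intros)
    ultimately show ?thesis using t by (simp add: frac_op_def min_absorb2)
  qed
  moreover have "0 < ?c" using \<beta> False t by (auto intro!: mult_pos_pos rGamma_pos)
  ultimately show thesis by (intro that)
qed

text \<open>The difference is 2 k \<beta> \<open>rGamma (1 - \<beta>)\<close> r^(2 - \<beta>) / (2 -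
  \<beta>), which is O(r) since 2 - \<beta> \<ge> 1 and r \<le> 1. It pays for the opposite
  curvatures of the two test functions.\<close>

lemma frac_op_sign_flip_bound:
  assumes \<beta>: "\<beta> \<in> {0<..1}" and k: "0 \<le> k" and e: "0 < e"
  obtains r0 where "0 < r0" "\<And>r A g R. \<lbrakk>0 < r; r \<le> r0\<rbrakk>
    \<Longrightarrow> frac_op \<beta> r R A k g - frac_op \<beta> r R A (- k) g \<le> e"
proof
  let ?K = "2 * k * rGamma (1 - \<beta>)"
  have K: "0 \<le> ?K" using k \<beta> by (auto intro!: mult_nonneg_nonneg rGamma_nonneg)
  show "0 < min 1 (e / (?K + 1))" using e K by (simp add: add_nonneg_pos)
  fix r A g R assume r: "0 < r" "r \<le> min 1 (e / (?K + 1))"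
  have "r powr (2 - \<beta>) \<le> r powr 1" using r \<beta> by (intro powr_mono') auto
  moreover have "\<beta> / (2 - \<beta>) \<le> 1" "0 \<le> \<beta> / (2 - \<beta>)" using \<beta> by auto
  ultimately have "\<beta> / (2 - \<beta>) * r powr (2 - \<beta>) \<le> 1 * r"
    using r by (intro mult_mono) auto
  then have "?K * (\<beta> / (2 - \<beta>) * r powr (2 - \<beta>)) \<le> ?K * r"
    using K by (intro mult_left_mono) auto
  also have "\<dots> \<le> (?K + 1) * r" using r by simp
  also have "\<dots> \<le> e" using r K by (simp add: field_simps add_nonneg_pos)
  finally show "frac_op \<beta> r R A k g - frac_op \<beta> r R A (- k) g \<le> e"
    by (simp add: frac_op_def mult_ac)
qed

text \<open>Every constant is chosen from \<open>v\<close>, \<open>H\<close>, \<open>u0\<close> and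
  earlier constants: first those of the gap, then the space penalty, then the time penalty, then r.
  The order is brought close to beta last, and a maximum with a large excess is then
  contradictory.\<close>

lemma one_sided_convergence:
  fixes H :: "real \<Rightarrow> real^'d \<Rightarrow> real \<Rightarrow> real^'d \<Rightarrow> real"
    and U :: "real \<Rightarrow> real \<Rightarrow> real^'d \<Rightarrow> real"
  assumes T: "0 < T"
    and per: "\<And>t x r p z. int_vec z \<Longrightarrow> H t (x + z) r p = H t x r p"
    and A1: "continuous_on ({0..T} \<times> UNIV \<times> UNIV \<times> UNIV) (\<lambda>(t, x, r, p). H t x r p)"
    and \<omega>: "modulus \<omega>"
    and A2: "\<And>t x y r p. t \<in> {0..T} \<Longrightarrow> \<bar>H t x r p - H t y r p\<bar> \<le> \<omega> (norm (x - y) * (1 + norm p))"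
    and mono: "\<And>t x r s p. \<lbrakk>t \<in> {0..T}; r \<le> s\<rbrakk> \<Longrightarrow> H t x r p \<le> H t x s p"
    and u0: "continuous_on UNIV u0" "periodic_fn u0"
    and \<beta>: "\<beta> \<in> {0<..1}"
    and U: "\<And>\<alpha>. \<alpha> \<in> {0<..<1} \<Longrightarrow> quad_subsol \<alpha> T H (U \<alpha>)"
      "\<And>\<alpha>. \<alpha> \<in> {0<..<1} \<Longrightarrow> periodic_x (U \<alpha>)"
      "\<And>\<alpha>. \<alpha> \<in> {0<..<1} \<Longrightarrow> continuous_on ({0..T} \<times> UNIV) (\<lambda>p. U \<alpha> (fst p) (snd p))"
      "\<And>\<alpha> x. \<alpha> \<in> {0<..<1} \<Longrightarrow> U \<alpha> 0 x = u0 x"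
    and v: "quad_subsol \<beta> T (dual_ham H) (\<lambda>s y. - v s y)" "periodic_x v"
      "continuous_on ({0..T} \<times> UNIV) (\<lambda>p. v (fst p) (snd p))" "\<And>x. v 0 x = u0 x"
    and \<eta>: "0 < \<eta>"
  shows "\<forall>\<^sub>F \<alpha> in at \<beta> within {0<..<1}. \<forall>t\<in>{0..T}. \<forall>x. U \<alpha> t x \<le> v t x + \<eta>"
proof -
  define m where "m = \<eta> / (4 * T)"
  have m: "0 < m" "m * T = \<eta> / 4" using \<eta> T by (auto simp: m_def)
  obtain M where M: "0 \<le> M" "\<And>t x. t \<in> {0..T} \<Longrightarrow> \<bar>v t x\<bar> \<le> M"
    using periodic_bounded[OF v(3,2)] by metis
  obtain C where C: "0 < C" "\<And>\<alpha> u t x. \<lbrakk>\<beta> / 2 \<le> \<alpha>; \<alpha> < 1; quad_subsol \<alpha> T H u; periodic_x u;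
      continuous_on ({0..T} \<times> UNIV) (\<lambda>p. u (fst p) (snd p)); \<And>x. u 0 x = u0 x; t \<in> {0..T}\<rbrakk>
      \<Longrightarrow> u t x \<le> u0 x + \<eta> / 8 + C * t"
    using initial_layer_bound[OF T per A1 mono u0, of "\<beta> / 2" "\<eta> / 8"] \<beta> \<eta> by auto
  obtain d1 where d1: "0 < d1" "\<And>t s x y. \<lbrakk>t \<in> {0..T}; s \<in> {0..T}; \<bar>t - s\<bar> < d1; norm (x - y) < d1\<rbrakk>
    \<Longrightarrow> \<bar>v t x - v s y\<bar> < \<eta> / 8"
    using periodic_uniformly_continuous[OF v(3,2), of "\<eta> / 8"] \<eta> by auto
  \<comment> \<open>For t \<le> t0 the layer bound puts \<open>U \<alpha>\<close> at most \<eta>/4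
    above the initial value, and s < d1 keeps \<open>v\<close> within \<eta>/8 of it. The excess is
    then below 3\<eta>/8, while a maximum carries more than 3\<eta>/4.\<close>
  define t0 where "t0 = min T (min (d1 / 4) (\<eta> / (8 * C)))"
  have "t0 \<le> \<eta> / (8 * C)" by (simp add: t0_def)
  then have "C * t0 \<le> \<eta> / 8" using C(1) by (simp add: field_simps)
  moreover have "0 < t0" using T d1(1) C(1) \<eta> by (simp add: t0_def)
  moreover have "t0 \<le> T" "t0 \<le> d1 / 4" by (simp_all add: t0_def)
  ultimately have t0: "0 < t0" "t0 \<le> T" "t0 \<le> d1 / 4" "C * t0 \<le> \<eta> / 8" by auto
  obtain c where c: "0 < c" "\<And>r. \<lbrakk>0 < r; r \<le> t0\<rbrakk> \<Longrightarrow> c \<le> frac_op \<beta> r T 1 0 (\<lambda>\<tau>. min \<tau> t0)"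
    using frac_op_linear_lower_bound[OF \<beta> t0(1,2)] by metis
  \<comment> \<open>After half of c is lost to the change of order, the gap is m c / 2 = 5 \<kappa>.
    The errors are \<kappa> for the order, \<kappa> for the curvature sign, and less than 2 \<kappa>
    for the Hamiltonian.\<close>
  define \<kappa> where "\<kappa> = m * c / 10"
  have \<kappa>: "0 < \<kappa>" using m c by (simp add: \<kappa>_def)
  obtain \<delta> where \<delta>: "0 < \<delta>" "\<And>\<rho>. \<lbrakk>0 \<le> \<rho>; \<rho> < \<delta>\<rbrakk> \<Longrightarrow> \<omega> \<rho> < \<kappa>"
  proof -
    have "\<forall>\<^sub>F \<rho> in at_right 0. \<omega> \<rho> < \<kappa>"
      using \<omega> \<kappa> by (auto simp: modulus_def intro: order_tendstoD)
    then obtain \<delta> where "0 < \<delta>" "\<And>\<rho>. \<lbrakk>0 < \<rho>; \<rho> < \<delta>\<rbrakk> \<Longrightarrow> \<omega> \<rho> < \<kappa>"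
      unfolding eventually_at_right_field by auto
    moreover have "\<omega> 0 < \<kappa>" using \<omega> \<kappa> by (simp add: modulus_def)
    ultimately show thesis by (intro that[of \<delta>]) (auto simp: le_less)
  qed
  \<comment> \<open>This makes l |x - y|^2 < \<delta>/8 whatever the size of l, because the penalty
    is bounded by the oscillation of \<open>v\<close>.\<close>
  obtain d2 where d2: "0 < d2" "\<And>t s x y. \<lbrakk>t \<in> {0..T}; s \<in> {0..T}; \<bar>t - s\<bar> < d2; norm (x - y) < d2\<rbrakk>
    \<Longrightarrow> \<bar>v t x - v s y\<bar> < \<delta> / 8"
    using periodic_uniformly_continuous[OF v(3,2), of "\<delta> / 8"] \<delta> by auto
  define d where "d = min (min d1 d2) (min (1/2) (\<delta> / 2))"
  have d: "0 < d" "d \<le> d1" "d \<le> d2" "d \<le> 1/2" "d \<le> \<delta> / 2"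
    using d1 d2 \<delta> by (auto simp: d_def)
  define l where "l = (2 * M + 1) / d\<^sup>2"
  have l: "0 < l" using M d by (simp add: l_def)
  \<comment> \<open>Bounds the gradient 2 l (x - y). The space penalty is fixed before the time
    scale because the continuity of \<open>H\<close> in time is uniform only for bounded
    gradients.\<close>
  define P where "P = 2 * l * d"
  obtain dH where dH: "0 < dH" "\<And>t s x r p. \<lbrakk>t \<in> {0..T}; s \<in> {0..T}; \<bar>t - s\<bar> < dH; \<bar>r\<bar> \<le> M; norm p \<le> P\<rbrakk>
     \<Longrightarrow> \<bar>H t x r p - H s x r p\<bar> < \<kappa>"
    using periodic_ham_uniformly_continuous_time[OF per A1 \<kappa>] by metis
  \<comment> \<open>The first entry gives s > t0/2 \<ge> r once t > t0, the second controls
    \<open>H\<close> in time, and the third keeps s < d1 in the initial layer.\<close>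
  define dt where "dt = min (t0 / 2) (min dH (d1 / 4))"
  have dt: "0 < dt" "dt \<le> t0 / 2" "dt \<le> dH" "dt \<le> d1 / 4"
    using t0 dH d1 by (auto simp: dt_def)
  define k where "k = (2 * M + 1) / dt\<^sup>2"
  have k: "0 < k" using M dt by (simp add: k_def)
  obtain r0 where r0: "0 < r0" "\<And>r A g R. \<lbrakk>0 < r; r \<le> r0\<rbrakk>
    \<Longrightarrow> frac_op \<beta> r R A k g - frac_op \<beta> r R A (- k) g \<le> \<kappa>"
    using frac_op_sign_flip_bound[OF \<beta> less_imp_le[OF k] \<kappa>] by metis
  define r where "r = min r0 (t0 / 2)"
  have r: "0 < r" "r \<le> r0" "r \<le> t0 / 2" "r \<le> t0" "r \<le> T" using r0 t0 by (auto simp: r_def)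
  have within: "F \<le> G \<Longrightarrow> eventually Q G \<Longrightarrow> eventually Q F" for F G :: "real filter" and Q
    by (simp add: le_filter_def)
  have sub01: "at \<beta> within {0<..<1} \<le> at \<beta> within {0..1}" by (intro at_le) auto
  have "\<forall>\<^sub>F \<alpha> in at \<beta> within {0<..<1}. \<alpha> \<in> {0<..<1} \<and> \<beta> / 2 \<le> \<alpha>"
  proof -
    have "\<alpha> \<in> {0<..<1} \<and> \<beta> / 2 \<le> \<alpha>" if "\<alpha> \<in> {0<..<1}" "dist \<alpha> \<beta> < \<beta> / 2" for \<alpha>
      using that by (auto simp: dist_real_def abs_if split: if_splits)
    then show ?thesis
      using \<beta> by (auto simp: eventually_at intro!: exI[of _ "\<beta> / 2"])
  qed
  moreover have "\<forall>\<^sub>F \<alpha> in at \<beta> within {0<..<1}. \<forall>A g. \<bar>A\<bar> \<le> 2 * k * dt \<and> continuous_on {r..T} g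
      \<and> (\<forall>\<tau>\<in>{r..T}. \<bar>g \<tau>\<bar> \<le> 2 * M) \<longrightarrow> \<bar>frac_op \<alpha> r T A (- k) g - frac_op \<beta> r T A (- k) g\<bar> \<le> \<kappa>"
    using \<beta> by (intro within[OF sub01] frac_op_continuous_in_order[OF r(1,5) _ \<kappa>]) auto
  moreover have "\<forall>\<^sub>F \<alpha> in at \<beta> within {0<..<1}. \<forall>A g. \<bar>A\<bar> \<le> 1 \<and> continuous_on {r..T} g
      \<and> (\<forall>\<tau>\<in>{r..T}. \<bar>g \<tau>\<bar> \<le> T) \<longrightarrow> \<bar>frac_op \<alpha> r T A 0 g - frac_op \<beta> r T A 0 g\<bar> \<le> c / 2"
    using \<beta> c by (intro within[OF sub01] frac_op_continuous_in_order[OF r(1,5)]) auto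
  ultimately show ?thesis
  proof eventually_elim
    case (elim \<alpha>)
    then have \<alpha>: "\<alpha> \<in> {0<..<1}" "\<beta> / 2 \<le> \<alpha>" by auto
    note U\<alpha> = U[OF \<alpha>(1)]
    let ?\<Phi> = "doubling k m l (U \<alpha>) v"
    show ?case
    proof (intro ballI allI, rule ccontr)
      fix t1 x1 assume t1: "t1 \<in> {0..T}" and "\<not> U \<alpha> t1 x1 \<le> v t1 x1 + \<eta>"
      then have big: "v t1 x1 + \<eta> < U \<alpha> t1 x1" by simp
      obtain t x s y where pt: "t \<in> {0..T}" "s \<in> {0..T}" "norm (x - y) \<le> 1"
        and max: "\<And>t' x' s' y'. \<lbrakk>t' \<in> {0..T}; s' \<in> {0..T}; norm (x' - y') \<le> 1\<rbrakk>
          \<Longrightarrow> ?\<Phi> t' x' s' y' \<le> ?\<Phi> t x s y"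
        by (rule doubling_max_exists[OF less_imp_le[OF T] U\<alpha>(3,2) v(3,2), of k m l]) blast
      have nonneg: "0 \<le> k * (t - s)\<^sup>2" "0 \<le> m * t" "0 \<le> l * (norm (x - y))\<^sup>2"
        using k m l pt by auto
      have "m * t1 \<le> \<eta> / 4"
        using mult_left_mono[of t1 T m] m t1 by simp
      then have val: "3 * \<eta> / 4 < U \<alpha> t x - v s y"
        using max[OF t1 t1, of x1 x1] big nonneg by (simp add: doubling_def)
      have lpen: "l * (norm (x - y))\<^sup>2 \<le> v s x - v s y"
        using max[OF pt(1,2), of x x] by (simp add: doubling_def)
      also have "\<dots> < l * d\<^sup>2"
        using M(2)[OF pt(2), of x] M(2)[OF pt(2), of y] d unfolding l_def by simp
      finally have nd: "norm (x - y) < d"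
        using l d by (simp add: power_less_imp_less_base)
      have "k * (t - s)\<^sup>2 \<le> v t y - v s y"
        using max[OF pt(1,1,3)] by (simp add: doubling_def)
      also have "\<dots> < k * dt\<^sup>2"
        using M(2)[OF pt(1), of y] M(2)[OF pt(2), of y] dt unfolding k_def by simp
      finally have "\<bar>t - s\<bar>\<^sup>2 < dt\<^sup>2" using k by simp
      then have td: "\<bar>t - s\<bar> < dt"
        by (rule power_less_imp_less_base) (use dt in simp)
      have tt0: "t0 < t"
      proof (rule ccontr)
        assume "\<not> t0 < t"
        then have "C * t \<le> C * t0" using C(1) by simp
        moreover have "U \<alpha> t x \<le> u0 x + \<eta> / 8 + C * t"
          using \<alpha> by (intro C(2)[OF _ _ U\<alpha>(1-4) pt(1)]) auto
        ultimately have "U \<alpha> t x \<le> u0 x + \<eta> / 8 + C * t0" by linarith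
        moreover have "\<bar>v 0 x - v s y\<bar> < \<eta> / 8"
          by (rule d1(2)) (use T pt td dt t0 nd d \<open>\<not> t0 < t\<close> in auto)
        ultimately show False using val t0 v(4)[of x] \<eta> by linarith
      qed
      then have rs: "r \<le> t" "r \<le> s" using td dt r by auto
      define p where "p = (2 * l) *\<^sub>R (x - y)"
      define A where "A = 2 * k * (t - s)"
      define g where "g = (\<lambda>\<tau>. v s y - v (max (s - \<tau>) 0) y)"
      have np: "norm p \<le> P" using l nd by (simp add: p_def P_def)
      have cg: "continuous_on {r..T} g"
        unfolding g_def using pt r by (intro continuous_on_backward[OF v(3)]) auto
      have gb: "\<bar>g \<tau>\<bar> \<le> 2 * M" if "\<tau> \<in> {r..T}" for \<tau>
      proof -
        have "max (s - \<tau>) 0 \<in> {0..T}" using that pt r by auto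
        from M(2)[OF this, of y] M(2)[OF pt(2), of y] show ?thesis
          unfolding g_def by linarith
      qed
      have "frac_op \<alpha> r T A (- k) g + m * frac_op \<alpha> r T 1 0 (\<lambda>\<tau>. min \<tau> t) - frac_op \<beta> r T A k g
          \<le> H s y (v s y) p - H t x (U \<alpha> t x) p"
        unfolding A_def g_def p_def
        by (rule doubling_max_inequality[OF U\<alpha>(1,3) v(1,3) _ _ r(1) rs pt(1,2) _ max])
          (use \<alpha> k nd d in auto)
      moreover have "\<bar>frac_op \<alpha> r T A (- k) g - frac_op \<beta> r T A (- k) g\<bar> \<le> \<kappa>"
      proof -
        have "\<bar>A\<bar> \<le> 2 * k * dt" using k td by (simp add: A_def abs_mult)
        then show ?thesis using elim cg gb by blast
      qed
      moreover have "frac_op \<beta> r T A k g - frac_op \<beta> r T A (- k) g \<le> \<kappa>"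
        by (rule r0(2)[OF r(1,2)])
      \<comment> \<open>Truncating at t0 instead of t makes the constant c independent of the
        maximum point; t0 < t and monotonicity of the operator lead back to t.\<close>
      moreover have "5 * \<kappa> \<le> m * frac_op \<alpha> r T 1 0 (\<lambda>\<tau>. min \<tau> t)"
      proof -
        have "continuous_on {r..T} (\<lambda>\<tau>. min \<tau> t0)" by (intro continuous_intros)
        moreover have "\<forall>\<tau>\<in>{r..T}. \<bar>min \<tau> t0\<bar> \<le> T" using r t0 by auto
        ultimately have "\<bar>frac_op \<alpha> r T 1 0 (\<lambda>\<tau>. min \<tau> t0) - frac_op \<beta> r T 1 0 (\<lambda>\<tau>. min \<tau> t0)\<bar> \<le> c / 2"
          using elim by (metis abs_one order_refl)
        moreover have "frac_op \<alpha> r T 1 0 (\<lambda>\<tau>. min \<tau> t0) \<le> frac_op \<alpha> r T 1 0 (\<lambda>\<tau>. min \<tau> t)"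
          by (rule frac_op_mono) (use \<alpha> r tt0 in \<open>auto intro!: continuous_intros\<close>)
        ultimately have "c / 2 \<le> frac_op \<alpha> r T 1 0 (\<lambda>\<tau>. min \<tau> t)"
          using c(2)[OF r(1,4)] by linarith
        then have "m * (c / 2) \<le> m * frac_op \<alpha> r T 1 0 (\<lambda>\<tau>. min \<tau> t)"
          using m by (intro mult_left_mono) auto
        then show ?thesis by (simp add: \<kappa>_def mult.commute)
      qed
      moreover have "H s y (v s y) p - H t x (U \<alpha> t x) p < 2 * \<kappa>"
      proof -
        \<comment> \<open>The excess at the maximum is positive, so monotonicity in r replaces
          \<open>U \<alpha>\<close> by \<open>v\<close>, whose values obey the bound M.\<close>
        have "H t x (v s y) p \<le> H t x (U \<alpha> t x) p"
          using val \<eta> by (intro mono pt) simp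
        moreover have "\<bar>H t x (v s y) p - H t y (v s y) p\<bar> < \<kappa>"
        proof -
          have "l * (norm (x - y))\<^sup>2 < \<delta> / 8"
          proof -
            have "\<bar>v s x - v s y\<bar> < \<delta> / 8" using pt nd d d2(1) by (intro d2(2)) auto
            then show ?thesis using lpen by linarith
          qed
          \<comment> \<open>The product of distance and gradient is twice the penalty, so the
            argument of the modulus is below \<delta>/2 + 2 \<delta>/8.\<close>
          moreover have "norm (x - y) * (1 + norm p) = norm (x - y) + 2 * (l * (norm (x - y))\<^sup>2)"
          proof -
            have "norm p = 2 * l * norm (x - y)" using l by (simp add: p_def)
            then show ?thesis by (simp add: power2_eq_square algebra_simps)
          qed
          ultimately have "norm (x - y) * (1 + norm p) < \<delta>" using nd d \<delta>(1) by linarith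
          then have "\<omega> (norm (x - y) * (1 + norm p)) < \<kappa>" by (intro \<delta>(2)) auto
          then show ?thesis using A2[OF pt(1), of x "v s y" p y] by linarith
        qed
        moreover have "\<bar>H t y (v s y) p - H s y (v s y) p\<bar> < \<kappa>"
          using td dt np M(2)[OF pt(2)] by (intro dH(2) pt) auto
        ultimately show ?thesis by linarith
      qed
      ultimately show False using \<kappa> by linarith
    qed
  qed
qed

section \<open>Two-sided convergence from the one-sided estimate\<close>

theorem theorem5p2:
  fixes H :: "real \<Rightarrow> real^'d \<Rightarrow> real \<Rightarrow> real^'d \<Rightarrow> real"
    and u0 :: "real^'d \<Rightarrow> real"
    and U :: "real \<Rightarrow> real \<Rightarrow> real^'d \<Rightarrow> real"
    and \<omega> :: "real \<Rightarrow> real"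
    and T \<beta> :: real
  assumes T: "T > 0"
    and H_periodic: "\<forall>t x r p z. int_vec z \<longrightarrow> H t (x + z) r p = H t x r p"
    and A1: "continuous_on ({0..T} \<times> UNIV \<times> UNIV \<times> UNIV) (\<lambda>(t, x, r, p). H t x r p)"
    and A2: "modulus \<omega>"
        "\<forall>t\<in>{0..T}. \<forall>x y r p. \<bar>H t x r p - H t y r p\<bar> \<le> \<omega> (norm (x - y) * (1 + norm p))"
    and A3: "\<forall>t\<in>{0..T}. \<forall>x r s p. r \<le> s \<longrightarrow> H t x r p \<le> H t x s p"
    and A4: "continuous_on UNIV u0" "periodic_fn u0"
    and sol_alpha: "\<forall>\<alpha>\<in>{0<..<1}. visc_solution \<alpha> T H u0 (U \<alpha>)"
    and beta: "\<beta> \<in> {0<..1}"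
    and sol_beta: "visc_solution \<beta> T H u0 (U \<beta>)"
  shows "\<forall>K. compact K \<and> K \<subseteq> {0<..T} \<times> UNIV \<longrightarrow>
           uniform_limit K (\<lambda>\<alpha> p. U \<alpha> (fst p) (snd p)) (\<lambda>p. U \<beta> (fst p) (snd p))
             (at \<beta> within {0<..<1})"
proof (intro allI impI, elim conjE)
  fix K :: "(real \<times> (real^'d)) set" assume K: "K \<subseteq> {0<..T} \<times> UNIV"
  let ?H = "dual_ham H"
  \<comment> \<open>The value beta is added separately because it may be 1, outside the open
    interval.\<close>
  have sol: "visc_solution \<alpha> T H u0 (U \<alpha>)" if "\<alpha> \<in> insert \<beta> {0<..<1}" for \<alpha>
    using that sol_alpha sol_beta by blast
  have U: "quad_subsol \<alpha> T H (U \<alpha>)" "quad_subsol \<alpha> T ?H (\<lambda>s y. - U \<alpha> s y)" "periodic_x (U \<alpha>)"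
    "continuous_on ({0..T} \<times> UNIV) (\<lambda>p. U \<alpha> (fst p) (snd p))" "\<And>x. U \<alpha> 0 x = u0 x"
    if "\<alpha> \<in> insert \<beta> {0<..<1}" for \<alpha>
  proof -
    have \<alpha>: "\<alpha> \<in> {0<..1}" using that beta by auto
    note s = sol[OF that, unfolded visc_solution_def]
    show "quad_subsol \<alpha> T H (U \<alpha>)" using s by (intro visc_sub_imp_quad_subsol[OF \<alpha>]) auto
    show "quad_subsol \<alpha> T ?H (\<lambda>s y. - U \<alpha> s y)" using s by (intro visc_super_imp_quad_subsol[OF \<alpha>]) auto
    show "periodic_x (U \<alpha>)" using s by (simp add: visc_sub_def)
    show "continuous_on ({0..T} \<times> UNIV) (\<lambda>p. U \<alpha> (fst p) (snd p))" "\<And>x. U \<alpha> 0 x = u0 x"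
      using s by auto
  qed
  have A1': "continuous_on ({0..T} \<times> UNIV \<times> UNIV \<times> UNIV) (\<lambda>(t, x, r, p). ?H t x r p)"
  proof -
    have "continuous_on ({0..T} \<times> UNIV \<times> UNIV \<times> UNIV)
        (\<lambda>q. - (\<lambda>(t, x, r, p). H t x r p) (fst q, fst (snd q), - fst (snd (snd q)), - snd (snd (snd q))))"
      by (intro continuous_on_minus continuous_on_compose2[OF A1]) (auto intro!: continuous_intros)
    then show ?thesis by (simp add: dual_ham_def case_prod_beta)
  qed
  show "uniform_limit K (\<lambda>\<alpha> p. U \<alpha> (fst p) (snd p)) (\<lambda>p. U \<beta> (fst p) (snd p)) (at \<beta> within {0<..<1})"
    unfolding uniform_limit_iff
  proof (intro allI impI)
    fix e :: real assume e: "0 < e"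
    have "\<forall>\<^sub>F \<alpha> in at \<beta> within {0<..<1}. \<forall>t\<in>{0..T}. \<forall>x. U \<alpha> t x \<le> U \<beta> t x + e / 2"
      by (rule one_sided_convergence[where H = H and ?u0.0 = u0 and \<omega> = \<omega>])
        (use T H_periodic A1 A2 A3 A4 beta U e in auto)
    \<comment> \<open>The estimate from below: \<open>- U \<alpha>\<close> is a subsolution for the
      dual Hamiltonian, and dualizing twice returns \<open>H\<close>, so \<open>- U \<beta>\<close>
      qualifies as the supersolution.\<close>
    moreover have "\<forall>\<^sub>F \<alpha> in at \<beta> within {0<..<1}. \<forall>t\<in>{0..T}. \<forall>x. - U \<alpha> t x \<le> - U \<beta> t x + e / 2"
    proof (rule one_sided_convergence[where H = ?H and ?u0.0 = "\<lambda>x. - u0 x" and \<omega> = \<omega>])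
      show "\<bar>?H t x r p - ?H t y r p\<bar> \<le> \<omega> (norm (x - y) * (1 + norm p))" if "t \<in> {0..T}" for t x y r p
        using A2(2)[rule_format, OF that, of x "- r" "- p" y] by (simp add: dual_ham_def)
      show "?H t x r p \<le> ?H t x s p" if "t \<in> {0..T}" "r \<le> s" for t x r s p
        using A3 that by (simp add: dual_ham_def)
      show "periodic_x (\<lambda>s y. - U \<alpha> s y)" if "\<alpha> \<in> {0<..<1}" for \<alpha>
        using U(3)[of \<alpha>] that by (simp add: periodic_x_def)
      show "periodic_x (\<lambda>s y. - U \<beta> s y)"
        using U(3)[of \<beta>] by (simp add: periodic_x_def)
      show "periodic_fn (\<lambda>x. - u0 x)" using A4(2) by (simp add: periodic_fn_def)
      show "?H t (x + z) r p = ?H t x r p" if "int_vec z" for t x r p z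
        using H_periodic that by (simp add: dual_ham_def)
    qed (use T A1' A2(1) A4(1) beta U e in \<open>auto intro!: continuous_intros\<close>)
    ultimately show "\<forall>\<^sub>F \<alpha> in at \<beta> within {0<..<1}. \<forall>p\<in>K. dist (U \<alpha> (fst p) (snd p)) (U \<beta> (fst p) (snd p)) < e"
    proof eventually_elim
      case (elim \<alpha>)
      show ?case
      proof
        fix p assume "p \<in> K"
        then have "fst p \<in> {0..T}" using K by (auto simp: mem_Times_iff)
        with elim have "U \<alpha> (fst p) (snd p) \<le> U \<beta> (fst p) (snd p) + e / 2"
          "- U \<alpha> (fst p) (snd p) \<le> - U \<beta> (fst p) (snd p) + e / 2" by blast+
        then show "dist (U \<alpha> (fst p) (snd p)) (U \<beta> (fst p) (snd p)) < e"
          using e unfolding dist_real_def by linarith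
      qed
    qed
  qed
qed

end
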